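(* Let $f_{i,j}:\mathbb S^2\to(0,\infty)$, $i,j=1,2,\dots$, be positive smooth functions such that (i) for some $0<T<\infty$, $\int_{\mathbb S^2}f_{i,j}\,d\mathrm{Vol}_{\mathbb S^2}\le T$ for all $i,j$; and (ii) $f_{i,j}\ge2$ and $\Delta f_{i,j}\le f_{i,j}$ on $\mathbb S^2$ for all $i,j$. Let $(A_i)_{i\ge1}$ be real numbers with $A_i\ge0$ for all $i$, $A_1>0$ and $\sum_{i=1}^\infty A_i=K<\infty$. For each $j\ge1$ let $$h_j=\sum_{i=1}^jA_if_{i,j},\qquad g_j=g_{\mathbb S^2}+h_j^2\,g_{\mathbb S^1}\ \text{ on }\mathbb S^2\times\mathbb S^1,$$ and write $\mathbb S^2\times_{h_j}\mathbb S^1=(\mathbb S^2\times\mathbb S^1,g_j)$. Then the scalar curvature of $\mathbb S^2\times_{h_j}\mathbb S^1$ is $\ge0$ everywhere for all $j$. Moreover, there exist $v>0$, $V>0$ and $D>0$ such that for all $j$ $$v\le\mathrm{Vol}(\mathbb S^2\times_{h_j}\mathbb S^1)\le V\quad\text{and}\quad\mathrm{Diam}(\mathbb S^2\times_{h_j}\mathbb S^1)\le D .$$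
   Context: $(\mathbb S^2,g_{\mathbb S^2})$ is the standard unit round sphere, $d\mathrm{Vol}_{\mathbb S^2}$ its volume form and $\Delta$ its Laplacian (with the sign convention $\Delta=\mathrm{div}\,\nabla$); $(\mathbb S^1,g_{\mathbb S^1})$ is the standard circle of length $2\pi$. *)

theory Defs
  imports "HOL-Analysis.Analysis"
begin

section \<open>Calculus on coordinate domains\<close>

definition pd :: "'n::finite \<Rightarrow> (real^'n \<Rightarrow> 'b::real_normed_vector) \<Rightarrow> real^'n \<Rightarrow> 'b" where
  "pd i f u = vector_derivative (\<lambda>t. f (u + t *\<^sub>R axis i 1)) (at 0)"

primrec Ck_on :: "nat \<Rightarrow> (real^'n) set \<Rightarrow> (real^'n::finite \<Rightarrow> real) \<Rightarrow> bool" where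
  "Ck_on 0 U f \<longleftrightarrow> continuous_on U f"
| "Ck_on (Suc k) U f \<longleftrightarrow> f differentiable_on U \<and> (\<forall>i. Ck_on k U (pd i f))"

text \<open>Only meant for open \<open>U\<close>.\<close>

definition smooth_on :: "(real^'n::finite) set \<Rightarrow> (real^'n \<Rightarrow> real) \<Rightarrow> bool" where
  "smooth_on U f \<longleftrightarrow> (\<forall>k. Ck_on k U f)"


section \<open>Riemannian geometry in a chart\<close>

text \<open>In this section \<open>G\<close> is the matrix-valued function \<open>u \<mapsto> (g\<^sub>i\<^sub>j(u))\<close> of the
  components of a Riemannian metric in local coordinates.\<close>

type_synonym 'n coord_metric = "real^'n \<Rightarrow> real^'n^'n"

definition chart_grad :: "('n::finite) coord_metric \<Rightarrow> (real^'n \<Rightarrow> real) \<Rightarrow> real^'n \<Rightarrow> real^'n" where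
  "chart_grad G f u = (\<chi> i. \<Sum>j\<in>UNIV. matrix_inv (G u) $ i $ j * pd j f u)"

definition chart_div :: "('n::finite) coord_metric \<Rightarrow> (real^'n \<Rightarrow> real^'n) \<Rightarrow> real^'n \<Rightarrow> real" where
  "chart_div G X u = (\<Sum>i\<in>UNIV. pd i (\<lambda>x. sqrt (det (G x)) * X x $ i) u) / sqrt (det (G u))"

definition chart_laplacian :: "('n::finite) coord_metric \<Rightarrow> (real^'n \<Rightarrow> real) \<Rightarrow> real^'n \<Rightarrow> real" where
  "chart_laplacian G f = chart_div G (chart_grad G f)"

text \<open>\<open>christoffel G k i j\<close> is \<open>\<Gamma>\<^sup>k\<^sub>i\<^sub>j\<close>, where \<open>\<nabla>\<^sub>i \<partial>\<^sub>j = \<Gamma>\<^sup>k\<^sub>i\<^sub>j \<partial>\<^sub>k\<close> for the Levi-Civita connection.\<close>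

definition christoffel :: "('n::finite) coord_metric \<Rightarrow> 'n \<Rightarrow> 'n \<Rightarrow> 'n \<Rightarrow> real^'n \<Rightarrow> real" where
  "christoffel G k i j u =
     (\<Sum>l\<in>UNIV. matrix_inv (G u) $ k $ l *
        (pd i (\<lambda>x. G x $ j $ l) u + pd j (\<lambda>x. G x $ i $ l) u - pd l (\<lambda>x. G x $ i $ j) u)) / 2"

text \<open>\<open>riemann G l k i j\<close> is the \<open>\<partial>\<^sub>l\<close>-component of
  \<open>R(\<partial>\<^sub>i,\<partial>\<^sub>j)\<partial>\<^sub>k = \<nabla>\<^sub>i\<nabla>\<^sub>j\<partial>\<^sub>k - \<nabla>\<^sub>j\<nabla>\<^sub>i\<partial>\<^sub>k\<close>; with this convention and the traces
  below the unit round 2-sphere has scalar curvature \<open>+2\<close>.\<close>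

definition riemann :: "('n::finite) coord_metric \<Rightarrow> 'n \<Rightarrow> 'n \<Rightarrow> 'n \<Rightarrow> 'n \<Rightarrow> real^'n \<Rightarrow> real" where
  "riemann G l k i j u =
     pd i (christoffel G l j k) u - pd j (christoffel G l i k) u
     + (\<Sum>p\<in>UNIV. christoffel G l i p u * christoffel G p j k u
                 - christoffel G l j p u * christoffel G p i k u)"

definition ricci :: "('n::finite) coord_metric \<Rightarrow> 'n \<Rightarrow> 'n \<Rightarrow> real^'n \<Rightarrow> real" where
  "ricci G j k u = (\<Sum>i\<in>UNIV. riemann G i k i j u)"

definition chart_scalar_curvature :: "('n::finite) coord_metric \<Rightarrow> real^'n \<Rightarrow> real" where
  "chart_scalar_curvature G u = (\<Sum>j\<in>UNIV. \<Sum>k\<in>UNIV. matrix_inv (G u) $ j $ k * ricci G j k u)"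


section \<open>Embedded manifolds with a Riemannian metric\<close>

text \<open>A manifold is a subset of a Euclidean space \<open>'a\<close>, with smooth structure given by a finite
  atlas of local parametrizations \<open>(U, \<phi>)\<close>, \<open>\<phi> : U \<rightarrow> 'a\<close>. A metric \<open>g\<close> takes a
  point and two tangent vectors at it (as vectors in the ambient space). Values of \<open>g\<close> at other
  arguments are irrelevant.\<close>

type_synonym ('n, 'a) atlas = "((real^'n) set \<times> (real^'n \<Rightarrow> 'a)) list"
type_synonym 'a metric_tensor = "'a \<Rightarrow> 'a \<Rightarrow> 'a \<Rightarrow> real"

definition pullback_metric ::
  "'a::euclidean_space metric_tensor \<Rightarrow> (real^'n::finite \<Rightarrow> 'a) \<Rightarrow> 'n coord_metric" where
  "pullback_metric g \<phi> u = (\<chi> i j. g (\<phi> u) (pd i \<phi> u) (pd j \<phi> u))"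

definition smooth_on_atlas :: "('n::finite, 'a) atlas \<Rightarrow> ('a \<Rightarrow> real) \<Rightarrow> bool" where
  "smooth_on_atlas As f \<longleftrightarrow> (\<forall>(U, \<phi>)\<in>set As. smooth_on U (f \<circ> \<phi>))"

text \<open>Integral of a nonnegative function against the Riemannian volume form. To count every
  point once, the \<open>k\<close>-th chart is integrated only over the points not covered by earlier charts.\<close>

definition riem_nn_integral ::
  "('n::finite, 'a) atlas \<Rightarrow> 'a::euclidean_space metric_tensor \<Rightarrow> ('a \<Rightarrow> ennreal) \<Rightarrow> ennreal" where
  "riem_nn_integral As g F =
     (\<Sum>k<length As. let (U, \<phi>) = As ! k in
        \<integral>\<^sup>+u\<in>{u\<in>U. \<forall>l<k. \<phi> u \<notin> snd (As ! l) ` fst (As ! l)}.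
           F (\<phi> u) * ennreal (sqrt (det (pullback_metric g \<phi> u))) \<partial>lborel)"

definition riem_volume :: "('n::finite, 'a) atlas \<Rightarrow> 'a::euclidean_space metric_tensor \<Rightarrow> ennreal" where
  "riem_volume As g = riem_nn_integral As g (\<lambda>_. 1)"

definition curve_length :: "'a::euclidean_space metric_tensor \<Rightarrow> (real \<Rightarrow> 'a) \<Rightarrow> ennreal" where
  "curve_length g c =
     (\<integral>\<^sup>+t\<in>{0..1}. ennreal (sqrt (g (c t) (vector_derivative c (at t)) (vector_derivative c (at t)))) \<partial>lborel)"

text \<open>\<^const>\<open>valid_path\<close> means piecewise \<open>C\<^sup>1\<close> on \<open>[0,1]\<close>.\<close>

definition riem_dist :: "'a::euclidean_space set \<Rightarrow> 'a metric_tensor \<Rightarrow> 'a \<Rightarrow> 'a \<Rightarrow> ennreal" where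
  "riem_dist M g x y =
     Inf {curve_length g c | c. valid_path c \<and> path_image c \<subseteq> M \<and> pathstart c = x \<and> pathfinish c = y}"

definition riem_diam :: "'a::euclidean_space set \<Rightarrow> 'a metric_tensor \<Rightarrow> ennreal" where
  "riem_diam M g = (SUP x\<in>M. SUP y\<in>M. riem_dist M g x y)"


section \<open>The round sphere, the unit circle, and warped products\<close>

definition euclid_metric :: "'a::euclidean_space metric_tensor" where
  "euclid_metric p v w = v \<bullet> w"

abbreviation S2 :: "(real^3) set" where "S2 \<equiv> sphere 0 1"
abbreviation S1 :: "complex set" where "S1 \<equiv> sphere 0 1"

text \<open>The standard metrics of \<^term>\<open>S2\<close> and \<^term>\<open>S1\<close> are those induced by the ambient Euclidean
  metric.\<close>

abbreviation g_S2 :: "(real^3) metric_tensor" where "g_S2 \<equiv> euclid_metric"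
abbreviation g_S1 :: "complex metric_tensor" where "g_S1 \<equiv> euclid_metric"

text \<open>Inverse stereographic projections from the north and the south pole.\<close>

definition stereo_N :: "real^2 \<Rightarrow> real^3" where
  "stereo_N u = (1 / (1 + u \<bullet> u)) *\<^sub>R vector [2 * u$1, 2 * u$2, u \<bullet> u - 1]"

definition stereo_S :: "real^2 \<Rightarrow> real^3" where
  "stereo_S u = (1 / (1 + u \<bullet> u)) *\<^sub>R vector [2 * u$1, 2 * u$2, 1 - u \<bullet> u]"

definition S2_atlas :: "(2, real^3) atlas" where
  "S2_atlas = [(UNIV, stereo_N), (UNIV, stereo_S)]"

definition S1_atlas :: "(1, complex) atlas" where
  "S1_atlas = [({x. 0 < x$1 \<and> x$1 < 2 * pi}, \<lambda>x. cis (x$1)),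
               ({x. - pi < x$1 \<and> x$1 < pi}, \<lambda>x. cis (x$1))]"

lemma S2_atlas_covers: "(\<Union>(U, \<phi>)\<in>set S2_atlas. \<phi> ` U) = S2"
proof -
  have sq: "u \<bullet> u = (u$1)\<^sup>2 + (u$2)\<^sup>2" for u :: "real^2"
    by (simp add: inner_vec_def sum_2 power2_eq_square)
  have S2_iff: "p \<in> S2 \<longleftrightarrow> (p$1)\<^sup>2 + (p$2)\<^sup>2 + (p$3)\<^sup>2 = 1" for p :: "real^3"
    by (simp add: norm_eq_1 inner_vec_def sum_3 power2_eq_square)
  have pos: "1 + ((a::real)\<^sup>2 + b\<^sup>2) \<noteq> 0" for a b
    by (metis add_pos_nonneg less_irrefl sum_power2_ge_zero zero_less_one)
  have N: "stereo_N u \<in> S2" and S: "stereo_S u \<in> S2" for u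
    using pos[of "u$1" "u$2"] unfolding S2_iff stereo_N_def stereo_S_def sq
    by (simp add: power_divide flip: add_divide_distrib, simp add: power2_eq_square algebra_simps)+
  have surj: "p \<in> range stereo_N \<union> range stereo_S" if "p \<in> S2" for p
  proof -
    have p: "(p$1)\<^sup>2 + (p$2)\<^sup>2 = 1 - (p$3)\<^sup>2"
      using that unfolding S2_iff by simp
    show ?thesis
    proof (cases "p$3 = 1")
      case True
      then have "p = stereo_S 0"
        using p by (simp add: stereo_S_def vec_eq_iff forall_3 sum_power2_eq_zero_iff)
      then show ?thesis by blast
    next
      case False
      define u :: "real^2" where "u = vector [p$1 / (1 - p$3), p$2 / (1 - p$3)]"
      have "u \<bullet> u = (1 - (p$3)\<^sup>2) / (1 - p$3)\<^sup>2"
        by (simp add: sq u_def power_divide flip: p add_divide_distrib)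
      also have "\<dots> = (1 + p$3) / (1 - p$3)"
      proof -
        have "1 - (p$3)\<^sup>2 = (1 + p$3) * (1 - p$3)"
          by (simp add: algebra_simps power2_eq_square)
        then show ?thesis
          using False by (simp add: power2_eq_square)
      qed
      finally have "1 + u \<bullet> u = 2 / (1 - p$3)" "u \<bullet> u - 1 = 2 * p$3 / (1 - p$3)"
        using False by (simp_all add: field_simps)
      then have "p = stereo_N u"
        using False by (simp add: stereo_N_def vec_eq_iff forall_3 u_def)
      then show ?thesis by blast
    qed
  qed
  show ?thesis
    using N S surj unfolding S2_atlas_def by (simp del: mem_sphere mem_sphere_0) blast
qed

lemma S1_atlas_covers: "(\<Union>(U, \<phi>)\<in>set S1_atlas. \<phi> ` U) = S1"
proof -
  have "z \<in> (\<lambda>x::real^1. cis (x$1)) ` {x. 0 < x$1 \<and> x$1 < 2 * pi} \<union>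
            (\<lambda>x::real^1. cis (x$1)) ` {x. - pi < x$1 \<and> x$1 < pi}" if "z \<in> S1" for z
  proof -
    have z: "z = cis (Arg z)"
      using that rcis_cmod_Arg[of z] by (simp add: rcis_def)
    show ?thesis
    proof (cases "Arg z = pi")
      case True
      then have "z = cis ((vec pi :: real^1)$1)" using z by simp
      then show ?thesis by (intro UnI1 image_eqI[of _ _ "vec pi"]) auto
    next
      case False
      then have "Arg z < pi" "- pi < Arg z"
        using mpi_less_Arg[of z] Arg_le_pi[of z] by auto
      then show ?thesis
        using z by (intro UnI2 image_eqI[of _ _ "vec (Arg z)"]) auto
    qed
  qed
  moreover have "cis (x$1) \<in> S1" for x :: "real^1" by simp
  ultimately show ?thesis
    unfolding S1_atlas_def by (simp del: mem_sphere mem_sphere_0) blast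
qed

definition prod_chart ::
  "(real^2) set \<times> (real^2 \<Rightarrow> 'a) \<Rightarrow> (real^1) set \<times> (real^1 \<Rightarrow> 'b)
     \<Rightarrow> (real^3) set \<times> (real^3 \<Rightarrow> 'a \<times> 'b)" where
  "prod_chart c d =
     ({u. vector [u$1, u$2] \<in> fst c \<and> vector [u$3] \<in> fst d},
      \<lambda>u. (snd c (vector [u$1, u$2]), snd d (vector [u$3])))"

definition S2xS1_atlas :: "(3, (real^3) \<times> complex) atlas" where
  "S2xS1_atlas = [prod_chart c d. c \<leftarrow> S2_atlas, d \<leftarrow> S1_atlas]"

lemma S2xS1_atlas_covers: "(\<Union>(U, \<phi>)\<in>set S2xS1_atlas. \<phi> ` U) = S2 \<times> S1"
proof -
  have *: "snd (prod_chart c d) ` fst (prod_chart c d) = snd c ` fst c \<times> snd d ` fst d"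
    for c :: "(real^2) set \<times> (real^2 \<Rightarrow> real^3)" and d :: "(real^1) set \<times> (real^1 \<Rightarrow> complex)"
  proof -
    have "(snd c x, snd d y) \<in> snd (prod_chart c d) ` fst (prod_chart c d)"
      if "x \<in> fst c" "y \<in> fst d" for x y
    proof -
      have "vector [x$1, x$2] = x" "vector [y$1] = y"
        by (simp_all add: vec_eq_iff forall_2 forall_1)
      then show ?thesis
        using that by (intro image_eqI[of _ _ "vector [x$1, x$2, y$1]"]) (auto simp: prod_chart_def)
    qed
    then show ?thesis by (fastforce simp: prod_chart_def)
  qed
  have "(\<Union>(U, \<phi>)\<in>set S2xS1_atlas. \<phi> ` U)
        = (\<Union>c\<in>set S2_atlas. \<Union>d\<in>set S1_atlas. snd (prod_chart c d) ` fst (prod_chart c d))"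
    by (simp add: S2xS1_atlas_def case_prod_unfold)
  also have "\<dots> = (\<Union>(U, \<phi>)\<in>set S2_atlas. \<phi> ` U) \<times> (\<Union>(U, \<phi>)\<in>set S1_atlas. \<phi> ` U)"
    unfolding * case_prod_unfold by blast
  finally show ?thesis
    unfolding S2_atlas_covers S1_atlas_covers .
qed

text \<open>The metric \<open>g\<^sub>B + h\<^sup>2 g\<^sub>F\<close> on a product.\<close>

definition warped_metric ::
  "'a metric_tensor \<Rightarrow> 'b metric_tensor \<Rightarrow> ('a \<Rightarrow> real) \<Rightarrow> ('a \<times> 'b) metric_tensor" where
  "warped_metric gB gF h p v w =
     gB (fst p) (fst v) (fst w) + (h (fst p))\<^sup>2 * gF (snd p) (snd v) (snd w)"

end

(* In a product of an isothermal chart of the base and an arc-length chart of the circle, the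
   metric is diag(a, a, h^2), and its scalar curvature is that of the base minus 2 (Laplacian h) / h.
   Over the unit sphere this is 2 - 2 (Laplacian h) / h, which is nonnegative as soon as
   Laplacian h <= h; this inequality is inherited by the nonnegative combinations h_j.

   By Fubini, the volume is 2 pi times the integral of h_j over the sphere, which is at most K T, and
   is bounded below because h_j >= 2 A_1.  The functions h_j need not be uniformly bounded, but the
   integral bound yields for each j a point p0 with h_j(p0) <= C, where C does not depend on j.  The
   fibre over p0 is then a shortcut: every pair of points is joined by a path of length at most a
   constant that passes through this fibre. *)
theory Submission
  imports Defs
begin

section \<open>Partial derivatives and diagonal metrics\<close>

text \<open>A curve inside a slice S2 x {z} has its spherical length, whatever \<open>h j\<close>
  is; only motion along the circle is charged the factor \<open>h j\<close>. This is why control of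
  \<open>h j\<close> at one point of the sphere already bounds the diameter. The constant C comes
  from the unit square of a stereographic chart, whose area on the sphere is at least 4/9: if
  \<open>h j\<close> were at least C everywhere, its integral would be at least 4/9 * C, which
  exceeds K * T for C = 9/4 * (K * T) + 1. Curvature is asserted in each of the four product charts,
  so both stereographic projections are treated at once through a sign s with s^2 = 1. The volume,
  in contrast, can be computed in the first chart alone, since the later charts contribute only null
  sets. All estimates concern the finite sums \<open>h j\<close>, with constants depending only on
  K, T and \<open>A 1\<close>; no limit of the sequence is taken.\<close>

lemma has_pd:
  fixes f :: "real^'n \<Rightarrow> 'b::real_normed_vector"
  assumes "f differentiable (at u)"
  shows "((\<lambda>t. f (u + t *\<^sub>R axis i 1)) has_vector_derivative pd i f u) (at 0)"
proof -
  have "(\<lambda>t. f (u + t *\<^sub>R axis i 1)) differentiable (at 0)"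
    using differentiable_chain_at[of "\<lambda>t. u + t *\<^sub>R axis i 1" 0 f] assms
    by (simp add: o_def)
  then show ?thesis
    unfolding pd_def by (simp add: vector_derivative_works)
qed

lemma has_pd_real:
  fixes f :: "real^'n \<Rightarrow> real"
  assumes "f differentiable (at u)"
  shows "((\<lambda>t. f (u + t *\<^sub>R axis i 1)) has_real_derivative pd i f u) (at 0)"
  using has_pd[OF assms] by (simp add: has_real_derivative_iff_has_vector_derivative)

lemma pd_eqI:
  fixes f :: "real^'n \<Rightarrow> real"
  assumes "((\<lambda>t. f (u + t *\<^sub>R axis i 1)) has_real_derivative d) (at 0)"
  shows "pd i f u = d"
  using assms unfolding pd_def
  by (simp add: has_real_derivative_iff_has_vector_derivative vector_derivative_at)

lemma pd_const [simp]: "pd i (\<lambda>x. c) u = 0"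
  by (simp add: pd_def)

context
  fixes f g :: "real^'n \<Rightarrow> real" and u :: "real^'n"
  assumes f: "f differentiable (at u)" and g: "g differentiable (at u)"
begin

lemma pd_add: "pd i (\<lambda>x. f x + g x) u = pd i f u + pd i g u"
  and pd_mult: "pd i (\<lambda>x. f x * g x) u = pd i f u * g u + f u * pd i g u"
  by (rule pd_eqI, (rule derivative_eq_intros has_pd_real[OF f] has_pd_real[OF g] refl | simp)+)+

lemma pd_divide:
  assumes "g u \<noteq> 0"
  shows "pd i (\<lambda>x. f x / g x) u = (pd i f u * g u - f u * pd i g u) / (g u)\<^sup>2"
  by (rule pd_eqI) (rule derivative_eq_intros has_pd_real[OF f] has_pd_real[OF g] refl
     | simp add: assms power2_eq_square)+

end

lemma pd_minus:
  fixes f :: "real^'n \<Rightarrow> real"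
  assumes "f differentiable (at u)"
  shows "pd i (\<lambda>x. - f x) u = - pd i f u"
  by (rule pd_eqI) (rule derivative_eq_intros has_pd_real[OF assms] refl)+

definition proj12 :: "real^3 \<Rightarrow> real^2" where
  "proj12 u = vector [u$1, u$2]"

text \<open>Functions on the base of the product chart are of the form \<open>F \<circ> proj12\<close>; \<open>lift_pd i F\<close> is
  the \<open>i\<close>-th partial derivative of such a function, again as a function on the base.\<close>

definition lift_pd :: "3 \<Rightarrow> (real^2 \<Rightarrow> real) \<Rightarrow> real^2 \<Rightarrow> real" where
  "lift_pd i F = (if i = 1 then pd 1 F else if i = 2 then pd 2 F else (\<lambda>_. 0))"

lemma lift_pd_simps [simp]:
  "lift_pd 1 F = pd 1 F" "lift_pd 2 F = pd 2 F" "lift_pd 3 F = (\<lambda>_. 0)"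
  by (simp_all add: lift_pd_def)

lemma pd_proj12: "pd i (\<lambda>u. F (proj12 u)) u = lift_pd i F (proj12 u)"
proof -
  have "proj12 (u + t *\<^sub>R axis 1 1) = proj12 u + t *\<^sub>R axis 1 1"
    "proj12 (u + t *\<^sub>R axis 2 1) = proj12 u + t *\<^sub>R axis 2 1"
    "proj12 (u + t *\<^sub>R axis 3 1) = proj12 u" for t
    by (simp_all add: proj12_def vec_eq_iff forall_2 axis_def)
  then show ?thesis
    using exhaust_3[of i] by (auto simp: pd_def)
qed

section \<open>Diagonal metrics: inverse and Christoffel symbols\<close>

definition diag_metric :: "('n \<Rightarrow> 'a \<Rightarrow> real) \<Rightarrow> 'a \<Rightarrow> real^'n^'n" where
  "diag_metric d u = (\<chi> i j. if i = j then d i u else 0)"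

lemma matrix_inv_diag_metric:
  fixes d :: "'n::finite \<Rightarrow> 'a \<Rightarrow> real"
  assumes "\<And>i. d i u \<noteq> 0"
  shows "matrix_inv (diag_metric d u) = diag_metric (\<lambda>i u. 1 / d i u) u"
proof -
  let ?A = "diag_metric d u" and ?B = "diag_metric (\<lambda>i u. 1 / d i u) u"
  have diag_mult: "diag_metric p u ** diag_metric q u = diag_metric (\<lambda>i u. p i u * q i u) u"
    for p q :: "'n \<Rightarrow> 'a \<Rightarrow> real"
  proof -
    have "(\<Sum>k\<in>UNIV. (if i = k then p i u else 0) * (if k = j then q k u else 0))
        = (\<Sum>k\<in>UNIV. if k = i then (if i = j then p i u * q i u else 0) else 0)" for i j
      by (rule sum.cong) auto
    then show ?thesis
      by (simp add: diag_metric_def matrix_matrix_mult_def vec_eq_iff)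
  qed
  have AB: "?A ** ?B = mat 1" "?B ** ?A = mat 1"
    using assms unfolding diag_mult by (simp_all add: diag_metric_def mat_def vec_eq_iff)
  \<comment> \<open>\<open>matrix_inv\<close> is a Hilbert choice. Since \<open>?B\<close> is a
    two-sided inverse, the chosen matrix is a left inverse too, and multiplying by \<open>?B\<close>
    on the right identifies it with \<open>?B\<close>.\<close>
  then have "matrix_inv ?A ** ?A = mat 1"
    unfolding matrix_inv_def by (metis (mono_tags, lifting) someI_ex)
  then have "matrix_inv ?A ** ?A ** ?B = ?B"
    by simp
  then show ?thesis
    by (simp add: AB flip: matrix_mul_assoc)
qed

text \<open>The off-diagonal entries are constantly 0, so their derivatives vanish, and the diagonal
  inverse keeps only the summand l = k.\<close>

lemma christoffel_diag_metric:
  fixes d :: "'n::finite \<Rightarrow> real^'n \<Rightarrow> real"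
  assumes "\<And>i. d i u \<noteq> 0"
  shows "christoffel (diag_metric d) k i j u =
    ((if j = k then pd i (d k) u else 0) + (if i = k then pd j (d k) u else 0)
      - (if i = j then pd k (d i) u else 0)) / (2 * d k u)"
proof -
  have pd: "pd i (\<lambda>x. diag_metric d x $ j $ l) u = (if j = l then pd i (d j) u else 0)" for i j l
    by (simp add: diag_metric_def)
  have sum_diag: "(\<Sum>l\<in>UNIV. diag_metric (\<lambda>i u. 1 / d i u) u $ k $ l * c l) = c k / d k u" for c
  proof -
    have "(\<Sum>l\<in>UNIV. diag_metric (\<lambda>i u. 1 / d i u) u $ k $ l * c l)
        = (\<Sum>l\<in>UNIV. if l = k then c k / d k u else 0)"
      by (rule sum.cong) (auto simp: diag_metric_def)
    then show ?thesis
      by simp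
  qed
  show ?thesis
    unfolding christoffel_def pd matrix_inv_diag_metric[of d u, OF assms] sum_diag by simp
qed

section \<open>Scalar curvature of a warped product over an isothermal chart\<close>

text \<open>With Delta_0 the flat Laplacian, the first two terms on the right are -(Delta_0 log a) /
  a, which is twice the Gauss curvature of the base metric a (dx^2 + dy^2). The last term is -2
  (Delta H) / H, because the Laplacian of the base is Delta_0 / a.\<close>

lemma scalar_curvature_isothermal_warped:
  fixes a H :: "real^2 \<Rightarrow> real" and G :: "3 coord_metric" and u :: "real^3"
  defines "x \<equiv> proj12 u"
  assumes G: "G = diag_metric (\<lambda>i u. if i = 3 then (H (proj12 u))\<^sup>2 else a (proj12 u))"
    and a: "\<And>x. a x \<noteq> 0" and H: "\<And>x. H x \<noteq> 0"
    and a_diff: "\<And>x. a differentiable (at x)" and H_diff: "\<And>x. H differentiable (at x)"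
    and pd_a_diff: "\<And>i x. pd i a differentiable (at x)"
    and pd_H_diff: "\<And>i x. pd i H differentiable (at x)"
  shows "chart_scalar_curvature G u =
    (pd 1 a x ^ 2 + pd 2 a x ^ 2) / a x ^ 3 - (pd 1 (pd 1 a) x + pd 2 (pd 2 a) x) / a x ^ 2
      - 2 * (pd 1 (pd 1 H) x + pd 2 (pd 2 H) x) / (a x * H x)"
proof -
  define e where "e i x = (if i = (3::3) then (H x)\<^sup>2 else a x)" for i x
  \<comment> \<open>The Christoffel symbols as functions on the base: every metric coefficient is
    constant along the circle, so \<open>lift_pd\<close> computes all their derivatives.\<close>
  define C where "C k i j = (\<lambda>x. ((if j = k then lift_pd i (e k) x else 0)
      + (if i = k then lift_pd j (e k) x else 0)
      - (if i = j then lift_pd k (e i) x else 0)) / (2 * e k x))" for k i j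
  have e0: "e i x \<noteq> 0" for i x
    using a H by (simp add: e_def)
  have e_simps: "e 1 = a" "e 2 = a" "e 3 = (\<lambda>x. (H x)\<^sup>2)"
    by (auto simp: e_def)
  have G: "G = diag_metric (\<lambda>i u. e i (proj12 u))"
    by (simp add: G e_def)
  have "christoffel G k i j u = C k i j (proj12 u)" for k i j u
    unfolding G by (subst christoffel_diag_metric) (auto simp: e0 pd_proj12 C_def)
  \<comment> \<open>An equality of functions and not only of values at \<open>u\<close>, because
    \<open>riemann\<close> differentiates the symbols.\<close>
  then have chr: "christoffel G k i j = (\<lambda>u. C k i j (proj12 u))" for k i j
    by blast
  have inv: "matrix_inv (G u) = (\<chi> i j. if i = j then 1 / e i x else 0)"
    unfolding G x_def
    by (subst matrix_inv_diag_metric[of "\<lambda>i u. e i (proj12 u)" u, OF e0]) (simp add: diag_metric_def)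
  have riem: "riemann G l k i j u = lift_pd i (C l j k) x - lift_pd j (C l i k) x
     + (\<Sum>p\<in>UNIV. C l i p x * C p j k x - C l j p x * C p i k x)" for l k i j
    unfolding riemann_def chr pd_proj12 x_def ..
  have R: "chart_scalar_curvature G u = (\<Sum>j\<in>UNIV. ricci G j j u / e j x)"
    unfolding chart_scalar_curvature_def inv by (simp add: if_distrib if_distribR cong: if_cong)
  \<comment> \<open>Logarithmic derivatives: in these the Christoffel symbols and their derivatives are polynomials,
    so that the Ricci components need no division.\<close>
  define \<alpha> where "\<alpha> i = (\<lambda>x. pd i a x / (2 * a x))" for i
  define \<eta> where "\<eta> i = (\<lambda>x. pd i H x / H x)" for i
  define \<kappa> where "\<kappa> = (\<lambda>x. (H x)\<^sup>2 / a x)"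
  define A where "A i j = pd i (pd j a) x / (2 * a x)" for i j
  define E where "E i j = pd i (pd j H) x / H x" for i j
  have a0: "a x \<noteq> 0" and H0: "H x \<noteq> 0"
    using a H by auto
  have diff: "\<alpha> i differentiable (at x)" "\<eta> i differentiable (at x)" "\<kappa> differentiable (at x)" for i
    unfolding \<alpha>_def \<eta>_def \<kappa>_def using a H a_diff H_diff pd_a_diff pd_H_diff by simp_all
  have pd_\<alpha>: "pd i (\<alpha> j) x = A i j - 2 * \<alpha> i x * \<alpha> j x" for i j
  proof -
    have "pd i (\<lambda>x. 2 * a x) x = 2 * pd i a x"
      by (subst pd_mult) (simp_all add: a_diff)
    then show ?thesis
      unfolding \<alpha>_def A_def using a0
      by (subst pd_divide) (simp_all add: pd_a_diff a_diff diff_divide_distrib power2_eq_square)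
  qed
  have pd_\<eta>: "pd i (\<eta> j) x = E i j - \<eta> i x * \<eta> j x" for i j
    unfolding \<eta>_def E_def using H0
    by (subst pd_divide) (simp_all add: pd_H_diff H_diff diff_divide_distrib power2_eq_square)
  have pd_sq: "pd i (\<lambda>x. (H x)\<^sup>2) x = 2 * H x * pd i H x" for i x
    unfolding power2_eq_square by (subst pd_mult) (simp_all add: H_diff)
  have pd_\<kappa>: "pd i \<kappa> x = 2 * \<kappa> x * (\<eta> i x - \<alpha> i x)" for i
    unfolding \<kappa>_def \<eta>_def \<alpha>_def using a0 H0
    by (subst pd_divide) (simp_all add: pd_sq H_diff a_diff, simp add: field_simps power2_eq_square)
  have pd_\<kappa>\<eta>: "pd i (\<lambda>x. - (\<kappa> x * \<eta> j x)) x
      = - (2 * \<kappa> x * (\<eta> i x - \<alpha> i x) * \<eta> j x + \<kappa> x * (E i j - \<eta> i x * \<eta> j x))" for i j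
    by (subst pd_minus, simp add: diff) (simp add: pd_mult diff pd_\<kappa> pd_\<eta>)
  have pd_m\<alpha>: "pd i (\<lambda>x. - \<alpha> j x) x = - (A i j - 2 * \<alpha> i x * \<alpha> j x)" for i j
    by (subst pd_minus) (simp_all add: diff pd_\<alpha>)
  \<comment> \<open>All 27 symbols. Those with indices 1 and 2 only are the symbols of the conformal
    base metric; of those involving the index 3, only Gamma^3_{i3} = Gamma^3_{3i} = \<eta> i and
    Gamma^i_{33} = - \<kappa> \<eta> i survive, for i = 1, 2.\<close>
  have C_simps:
    "C 1 1 1 = \<alpha> 1" "C 1 1 2 = \<alpha> 2" "C 1 2 1 = \<alpha> 2" "C 1 2 2 = (\<lambda>x. - \<alpha> 1 x)"
    "C 2 2 2 = \<alpha> 2" "C 2 2 1 = \<alpha> 1" "C 2 1 2 = \<alpha> 1" "C 2 1 1 = (\<lambda>x. - \<alpha> 2 x)"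
    "C 1 3 3 = (\<lambda>x. - (\<kappa> x * \<eta> 1 x))" "C 2 3 3 = (\<lambda>x. - (\<kappa> x * \<eta> 2 x))"
    "C 3 1 3 = \<eta> 1" "C 3 3 1 = \<eta> 1" "C 3 2 3 = \<eta> 2" "C 3 3 2 = \<eta> 2"
    "C 3 3 3 = (\<lambda>_. 0)" "C 1 1 3 = (\<lambda>_. 0)" "C 1 3 1 = (\<lambda>_. 0)" "C 1 2 3 = (\<lambda>_. 0)"
    "C 1 3 2 = (\<lambda>_. 0)" "C 2 1 3 = (\<lambda>_. 0)" "C 2 3 1 = (\<lambda>_. 0)" "C 2 2 3 = (\<lambda>_. 0)"
    "C 2 3 2 = (\<lambda>_. 0)" "C 3 1 1 = (\<lambda>_. 0)" "C 3 1 2 = (\<lambda>_. 0)" "C 3 2 1 = (\<lambda>_. 0)"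
    "C 3 2 2 = (\<lambda>_. 0)"
    using H by (simp_all add: C_def e_simps \<alpha>_def \<eta>_def \<kappa>_def pd_sq fun_eq_iff)
      (simp_all add: power2_eq_square)
  note eval = ricci_def riem sum_3 C_simps lift_pd_simps pd_const pd_\<alpha> pd_\<eta> pd_\<kappa>\<eta> pd_m\<alpha>
  have r1: "ricci G 1 1 u = 2 * (\<alpha> 1 x ^ 2 + \<alpha> 2 x ^ 2) - A 1 1 - A 2 2 - E 1 1
      + \<alpha> 1 x * \<eta> 1 x - \<alpha> 2 x * \<eta> 2 x"
    unfolding eval by (simp add: power2_eq_square)
  have r2: "ricci G 2 2 u = 2 * (\<alpha> 1 x ^ 2 + \<alpha> 2 x ^ 2) - A 1 1 - A 2 2 - E 2 2
      + \<alpha> 2 x * \<eta> 2 x - \<alpha> 1 x * \<eta> 1 x"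
    unfolding eval by (simp add: power2_eq_square)
  have r3: "ricci G 3 3 u = - (\<kappa> x * (E 1 1 + E 2 2))"
    unfolding eval by (simp add: algebra_simps)
  \<comment> \<open>The mixed terms in \<alpha> and \<eta> cancel between \<open>r1\<close> and
    \<open>r2\<close>. Dividing \<open>r3\<close> by H^2 turns \<kappa> into 1 / a, so the Hessian
    terms E appear a second time; this is the factor 2 in front of the Laplacian of H.\<close>
  have "chart_scalar_curvature G u
      = (4 * (\<alpha> 1 x ^ 2 + \<alpha> 2 x ^ 2) - 2 * (A 1 1 + A 2 2) - 2 * (E 1 1 + E 2 2)) / a x"
  proof -
    have "ricci G 3 3 u / e 3 x = - ((E 1 1 + E 2 2) / a x)"
      unfolding r3 e_simps \<kappa>_def using H0 by simp
    then show ?thesis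
      unfolding R sum_3 r1 r2 e_simps by (simp add: divide_inverse algebra_simps)
  qed
  also have "\<dots> = (pd 1 a x ^ 2 + pd 2 a x ^ 2) / a x ^ 3
      - (pd 1 (pd 1 a) x + pd 2 (pd 2 a) x) / a x ^ 2
      - 2 * (pd 1 (pd 1 H) x + pd 2 (pd 2 H) x) / (a x * H x)"
    unfolding \<alpha>_def A_def E_def
    by (simp add: add_divide_distrib diff_divide_distrib distrib_left mult.commute power2_eq_square power3_eq_cube)
  finally show ?thesis .
qed

section \<open>The round sphere in stereographic charts\<close>

text \<open>Along a coordinate line the squared norm is a quadratic polynomial in t, so partial
  derivatives of rational expressions in it become one-variable derivatives at t = 0.\<close>

lemma inner_add_axis:
  fixes u :: "real^'n"
  shows "(u + t *\<^sub>R axis i 1) \<bullet> (u + t *\<^sub>R axis i 1) = u \<bullet> u + 2 * t * u$i + t\<^sup>2"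
  by (simp add: inner_add_left inner_add_right inner_axis inner_axis_axis inner_commute power2_eq_square)

lemma one_plus_inner_pos: "0 < 1 + x \<bullet> x" for x :: "'a::real_inner"
  by (simp add: add_pos_nonneg)

text \<open>The round metric in a stereographic chart is \<open>conf_factor\<close> times the Euclidean one.\<close>

definition conf_factor :: "real^2 \<Rightarrow> real" where
  "conf_factor x = 4 / (1 + x \<bullet> x)\<^sup>2"

lemma conf_factor_pos: "0 < conf_factor x"
  using one_plus_inner_pos[of x] by (simp add: conf_factor_def)

lemma conf_factor_differentiable: "conf_factor differentiable (at x)"
  using one_plus_inner_pos[of x] unfolding conf_factor_def[abs_def] by (simp add: differentiable_inner)

lemma pd_conf_factor: "pd i conf_factor = (\<lambda>x. - 16 * x$i / (1 + x \<bullet> x) ^ 3)"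
proof
  fix x :: "real^2"
  define w where "w = 1 + x \<bullet> x"
  have w: "w \<noteq> 0"
    using one_plus_inner_pos[of x] by (simp add: w_def)
  have "((\<lambda>t. 4 / (w + (2 * t * x$i + t\<^sup>2))\<^sup>2) has_real_derivative - 16 * x$i / w ^ 3) (at 0)"
    using w by (auto intro!: derivative_eq_intros simp: field_simps power2_eq_square power3_eq_cube)
  then show "pd i conf_factor x = - 16 * x$i / (1 + x \<bullet> x) ^ 3"
    by (intro pd_eqI) (simp add: conf_factor_def inner_add_axis w_def add.assoc)
qed

lemma pd_pd_conf_factor:
  "pd i (pd i conf_factor) x = - 16 / (1 + x \<bullet> x) ^ 3 + 96 * (x$i)\<^sup>2 / (1 + x \<bullet> x) ^ 4"
proof -
  define w where "w = 1 + x \<bullet> x"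
  have w: "w \<noteq> 0"
    using one_plus_inner_pos[of x] by (simp add: w_def)
  have "((\<lambda>t. - 16 * (x$i + t) / (w + (2 * t * x$i + t\<^sup>2)) ^ 3) has_real_derivative
      - 16 / w ^ 3 + 96 * (x$i)\<^sup>2 / w ^ 4) (at 0)"
    using w by (auto intro!: derivative_eq_intros simp: field_simps eval_nat_numeral)
  moreover have "axis i (1::real) $ i = 1"
    by (simp add: axis_def)
  ultimately show ?thesis
    unfolding pd_conf_factor by (intro pd_eqI) (simp add: inner_add_axis w_def add.assoc)
qed

lemma pd_conf_factor_differentiable: "pd i conf_factor differentiable (at x)"
  using one_plus_inner_pos[of x]
    bounded_linear_imp_differentiable[OF bounded_linear_vec_nth[of i], of "at x"]
  unfolding pd_conf_factor by (simp add: differentiable_inner)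

lemma inner_real2: "x \<bullet> x = (x$1)\<^sup>2 + (x$2)\<^sup>2" for x :: "real^2"
  by (simp add: inner_vec_def sum_2 power2_eq_square)

text \<open>The round sphere has Gauss curvature 1. Everything depends only on w = 1 + |x|^2: the
  two quotients are 4 (w - 1) and 4 w - 6.\<close>

lemma conf_factor_curvature:
  "(pd 1 conf_factor x ^ 2 + pd 2 conf_factor x ^ 2) / conf_factor x ^ 3
    - (pd 1 (pd 1 conf_factor) x + pd 2 (pd 2 conf_factor) x) / conf_factor x ^ 2 = 2"
proof -
  define w where "w = 1 + x \<bullet> x"
  have w: "w \<noteq> 0"
    using one_plus_inner_pos[of x] by (simp add: w_def)
  have sq: "(x$1)\<^sup>2 + (x$2)\<^sup>2 = w - 1"
    by (simp add: w_def inner_real2)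
  have 1: "pd 1 conf_factor x ^ 2 + pd 2 conf_factor x ^ 2 = 256 * ((x$1)\<^sup>2 + (x$2)\<^sup>2) / w ^ 6"
    by (simp add: pd_conf_factor w_def power_divide power_mult_distrib add_divide_distrib flip: power_mult)
  have 2: "pd 1 (pd 1 conf_factor) x + pd 2 (pd 2 conf_factor) x
      = - 32 / w ^ 3 + 96 * ((x$1)\<^sup>2 + (x$2)\<^sup>2) / w ^ 4"
    by (simp add: pd_pd_conf_factor w_def add_divide_distrib)
  have 3: "conf_factor x = 4 / w\<^sup>2"
    by (simp add: conf_factor_def w_def)
  show ?thesis
    unfolding 1 2 3 sq using w by (simp add: field_simps eval_nat_numeral)
qed

section \<open>Coordinate vector fields of the stereographic charts\<close>

lemma has_vector_derivative_vector3:
  assumes "(a has_real_derivative a') F" "(b has_real_derivative b') F" "(c has_real_derivative c') F"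
  shows "((\<lambda>t. vector [a t, b t, c t] :: real^3) has_vector_derivative vector [a', b', c']) F"
proof -
  have eq: "vector [p, q, r] = p *\<^sub>R axis 1 1 + q *\<^sub>R axis 2 1 + r *\<^sub>R (axis 3 1 :: real^3)" for p q r
    by (simp add: vec_eq_iff forall_3 axis_def)
  have "((\<lambda>t. p t *\<^sub>R v) has_vector_derivative p' *\<^sub>R v) F"
    if "(p has_real_derivative p') F" for p p' and v :: "real^3"
    using bounded_linear.has_vector_derivative[OF bounded_linear_scaleR_left] that
    by (simp add: has_real_derivative_iff_has_vector_derivative)
  then show ?thesis
    unfolding eq using assms by (intro has_vector_derivative_add)
qed

text \<open>Both projections at once: the sign is \<open>1\<close> for the north pole and \<open>-1\<close> for the south pole.\<close>

definition stereo :: "real \<Rightarrow> real^2 \<Rightarrow> real^3" where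
  "stereo s u = (1 / (1 + u \<bullet> u)) *\<^sub>R vector [2 * u$1, 2 * u$2, s * (u \<bullet> u - 1)]"

lemma stereo_N_eq: "stereo_N = stereo 1" and stereo_S_eq: "stereo_S = stereo (-1)"
  by (simp_all add: fun_eq_iff stereo_def stereo_N_def stereo_S_def)

definition dstereo :: "real \<Rightarrow> 2 \<Rightarrow> real^2 \<Rightarrow> real^3" where
  "dstereo s i u = vector [(if i = 1 then 2 / (1 + u \<bullet> u) else 0) - 4 * u$1 * u$i / (1 + u \<bullet> u)\<^sup>2,
     (if i = 2 then 2 / (1 + u \<bullet> u) else 0) - 4 * u$2 * u$i / (1 + u \<bullet> u)\<^sup>2,
     4 * s * u$i / (1 + u \<bullet> u)\<^sup>2]"

lemma stereo_has_pd:
  "((\<lambda>t. stereo s (u + t *\<^sub>R axis i 1)) has_vector_derivative dstereo s i u) (at 0)"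
proof -
  define w where "w = 1 + u \<bullet> u"
  have w: "w \<noteq> 0"
    using one_plus_inner_pos[of u] by (simp add: w_def)
  \<comment> \<open>The value of 1 + |u|^2 along the coordinate line; hence |u|^2 - 1 becomes
    \<open>m t - 2\<close> in the third component.\<close>
  define m where "m t = w + (2 * t * u$i + t\<^sup>2)" for t
  have m: "(m has_real_derivative 2 * u$i) (at 0)" and m0: "m 0 = w"
    unfolding m_def by (auto intro!: derivative_eq_intros)
  have "((\<lambda>t. 2 * (u$k + t * c) / m t) has_real_derivative
      2 * c / w - 4 * u$k * u$i / w\<^sup>2) (at 0)" for c k
    using w by (auto intro!: derivative_eq_intros m simp: m0 divide_simps power2_eq_square)
  moreover have "((\<lambda>t. s * (m t - 2) / m t) has_real_derivative 4 * s * u$i / w\<^sup>2) (at 0)"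
    using w by (auto intro!: derivative_eq_intros m simp: m0 divide_simps power2_eq_square) (simp add: algebra_simps)
  ultimately have "((\<lambda>t. vector [2 * (u$1 + t * (if i = 1 then 1 else 0)) / m t,
      2 * (u$2 + t * (if i = 2 then 1 else 0)) / m t, s * (m t - 2) / m t] :: real^3)
    has_vector_derivative
      vector [2 * (if i = 1 then 1 else 0) / w - 4 * u$1 * u$i / w\<^sup>2,
        2 * (if i = 2 then 1 else 0) / w - 4 * u$2 * u$i / w\<^sup>2, 4 * s * u$i / w\<^sup>2]) (at 0)"
    by (intro has_vector_derivative_vector3)
  also have "(\<lambda>t. vector [2 * (u$1 + t * (if i = 1 then 1 else 0)) / m t,
      2 * (u$2 + t * (if i = 2 then 1 else 0)) / m t, s * (m t - 2) / m t] :: real^3)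
    = (\<lambda>t. stereo s (u + t *\<^sub>R axis i 1))"
  proof -
    have axis: "axis i (1::real) $ k = (if i = k then 1 else 0)" for k
      by (simp add: axis_def)
    show ?thesis
      by (simp add: fun_eq_iff vec_eq_iff forall_3 stereo_def inner_add_axis m_def w_def axis add.assoc)
  qed
  also have "vector [2 * (if i = 1 then 1 else 0) / w - 4 * u$1 * u$i / w\<^sup>2,
        2 * (if i = 2 then 1 else 0) / w - 4 * u$2 * u$i / w\<^sup>2, 4 * s * u$i / w\<^sup>2] = dstereo s i u"
    by (simp add: dstereo_def w_def)
  finally show ?thesis .
qed

text \<open>Stereographic projection is conformal. Writing p for 1 / (1 + |u|^2) makes all entries
  polynomial, and the claims follow from the relations (1 + |u|^2) p = 1 and s^2 = 1.\<close>

lemma inner_dstereo: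
  assumes "s\<^sup>2 = 1"
  shows "dstereo s i u \<bullet> dstereo s j u = (if i = j then conf_factor u else 0)"
proof -
  define p where "p = 1 / (1 + u \<bullet> u)"
  have p: "(1 + (u$1)\<^sup>2 + (u$2)\<^sup>2) * p = 1"
    using one_plus_inner_pos[of u] by (simp add: p_def inner_real2 add.assoc)
  have d: "dstereo s i u = vector [(if i = 1 then 2 * p else 0) - 4 * u$1 * u$i * p\<^sup>2,
     (if i = 2 then 2 * p else 0) - 4 * u$2 * u$i * p\<^sup>2, 4 * s * u$i * p\<^sup>2]" for i
    by (simp add: dstereo_def p_def power_divide)
  have c: "conf_factor u = 4 * p\<^sup>2"
    by (simp add: conf_factor_def p_def power_divide)
  have "dstereo s 1 u \<bullet> dstereo s 1 u = 4 * p\<^sup>2" "dstereo s 2 u \<bullet> dstereo s 2 u = 4 * p\<^sup>2"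
    "dstereo s 1 u \<bullet> dstereo s 2 u = 0"
    unfolding d inner_vec_def sum_3 using p assms by (simp_all, algebra+)
  then show ?thesis
    using exhaust_2[of i] exhaust_2[of j] by (auto simp: c inner_commute)
qed

lemma pd_stereo: "pd i (stereo s) u = dstereo s i u"
  unfolding pd_def by (rule vector_derivative_at[OF stereo_has_pd])

lemma pullback_stereo:
  assumes "s\<^sup>2 = 1"
  shows "pullback_metric g_S2 (stereo s) = diag_metric (\<lambda>_. conf_factor)"
  by (simp add: fun_eq_iff pullback_metric_def diag_metric_def euclid_metric_def pd_stereo
      inner_dstereo[OF assms])

section \<open>The Laplacian and the warped metric in these charts\<close>

lemma det_diag_metric:
  fixes d :: "'n::finite \<Rightarrow> 'a \<Rightarrow> real"
  shows "det (diag_metric d u) = (\<Prod>i\<in>UNIV. d i u)"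
  by (subst det_diagonal) (simp_all add: diag_metric_def)

text \<open>In dimension two the density sqrt (det G) = a cancels the factor 1 / a of the gradient,
  as an identity of functions. The outer divergence therefore acts on the flat gradient, and one
  factor 1 / a remains.\<close>

lemma chart_laplacian_isothermal:
  fixes a :: "real^2 \<Rightarrow> real"
  assumes a: "\<And>x. 0 < a x"
  shows "chart_laplacian (diag_metric (\<lambda>_. a)) F u = (pd 1 (pd 1 F) u + pd 2 (pd 2 F) u) / a u"
proof -
  have a0: "a x \<noteq> 0" for x
    using a[of x] by simp
  have sqrt_det: "sqrt (det (diag_metric (\<lambda>_::2. a) x)) = a x" for x
    using a[of x] by (simp add: det_diag_metric)
  have grad: "chart_grad (diag_metric (\<lambda>_::2. a)) F x $ i = pd i F x / a x" for x i
    using exhaust_2[of i] unfolding chart_grad_def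
    by (subst matrix_inv_diag_metric) (auto simp: a0 diag_metric_def sum_2)
  have "(\<lambda>x. a x * (pd i F x / a x)) = pd i F" for i
    using a0 by simp
  then show ?thesis
    by (simp add: chart_laplacian_def chart_div_def sqrt_det grad sum_2)
qed

lemma has_vector_derivative_cis_affine:
  "((\<lambda>t. cis (c + d * t)) has_vector_derivative d *\<^sub>R (\<i> * cis (c + d * t))) (at t within S)"
  unfolding has_vector_derivative_def by (rule derivative_eq_intros refl)+ (simp add: mult.commute)

text \<open>The first two coordinate fields lie in the sphere factor and the third in the circle
  factor, so the mixed entries vanish; \<open>cis\<close> has unit speed, which leaves the square of
  \<open>h\<close> as the last entry.\<close>

lemma pullback_warped_prod:
  assumes s: "s\<^sup>2 = 1"
  shows "pullback_metric (warped_metric g_S2 g_S1 h)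
      (\<lambda>u. (stereo s (proj12 u), cis (u$3)))
    = diag_metric (\<lambda>i u. if i = 3 then (h (stereo s (proj12 u)))\<^sup>2 else conf_factor (proj12 u))"
    (is "pullback_metric _ ?\<phi> = _")
proof
  fix u :: "real^3"
  let ?x = "proj12 u"
  have shift: "?\<phi> (u + t *\<^sub>R axis 1 1) = (stereo s (?x + t *\<^sub>R axis 1 1), cis (u$3))"
    "?\<phi> (u + t *\<^sub>R axis 2 1) = (stereo s (?x + t *\<^sub>R axis 2 1), cis (u$3))"
    "?\<phi> (u + t *\<^sub>R axis 3 1) = (stereo s ?x, cis (u$3 + t))" for t
    by (simp_all add: proj12_def axis_def)
       (rule arg_cong[of _ _ "stereo s"], simp add: vec_eq_iff forall_2 axis_def)+
  have cis: "((\<lambda>t. cis (u$3 + t)) has_vector_derivative \<i> * cis (u$3)) (at 0)"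
    using has_vector_derivative_cis_affine[of "u$3" 1 0] by simp
  have pd: "pd 1 ?\<phi> u = (dstereo s 1 ?x, 0)" "pd 2 ?\<phi> u = (dstereo s 2 ?x, 0)"
      "pd 3 ?\<phi> u = (0, \<i> * cis (u$3))"
    unfolding pd_def shift
    by (auto intro!: vector_derivative_at has_vector_derivative_Pair stereo_has_pd cis
        has_vector_derivative_const)
  have "(\<i> * cis (u$3)) \<bullet> (\<i> * cis (u$3)) = 1"
    by (simp add: dot_square_norm norm_mult)
  then show "pullback_metric (warped_metric g_S2 g_S1 h) ?\<phi> u
    = diag_metric (\<lambda>i u. if i = 3 then (h (stereo s (proj12 u)))\<^sup>2 else conf_factor (proj12 u)) u"
    by (simp add: vec_eq_iff forall_3 pullback_metric_def diag_metric_def warped_metric_def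
        euclid_metric_def pd inner_dstereo[OF s])
qed

lemma smooth_on_UNIV_D:
  assumes "smooth_on UNIV F"
  shows "F differentiable (at x)" "pd i F differentiable (at x)"
proof -
  have "Ck_on (Suc (Suc 0)) UNIV F"
    using assms unfolding smooth_on_def by blast
  then show "F differentiable (at x)" "pd i F differentiable (at x)"
    by (auto simp: differentiable_on_def)
qed

text \<open>An equality of functions, so that it can be applied twice to obtain second
  derivatives.\<close>

lemma pd_sum_scaled:
  fixes F :: "'k \<Rightarrow> real^'n \<Rightarrow> real"
  assumes "finite S" "\<And>k x. k \<in> S \<Longrightarrow> F k differentiable (at x)"
  shows "pd i (\<lambda>x. \<Sum>k\<in>S. c k * F k x) = (\<lambda>x. \<Sum>k\<in>S. c k * pd i (F k) x)"
  using assms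
proof (induction S)
  case (insert k S)
  then have *: "F k differentiable (at x)" "(\<lambda>x. \<Sum>k\<in>S. c k * F k x) differentiable (at x)" for x
    by simp_all
  then have "pd i (\<lambda>x. c k * F k x + (\<Sum>k\<in>S. c k * F k x)) x
      = c k * pd i (F k) x + pd i (\<lambda>x. \<Sum>k\<in>S. c k * F k x) x" for x
    by (simp add: pd_add pd_mult)
  then show ?case
    using insert by simp
qed (simp add: fun_eq_iff)

lemma scalar_curvature_warped_sphere:
  assumes s: "s\<^sup>2 = 1"
    and H_pos: "\<And>x. 0 < h (stereo s x)"
    and H_diff: "\<And>x. (\<lambda>x. h (stereo s x)) differentiable (at x)"
      "\<And>i x. pd i (\<lambda>x. h (stereo s x)) differentiable (at x)"
  shows "chart_scalar_curvature
      (pullback_metric (warped_metric g_S2 g_S1 h) (\<lambda>u. (stereo s (proj12 u), cis (u$3)))) u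
    = 2 - 2 * chart_laplacian (pullback_metric g_S2 (stereo s)) (\<lambda>x. h (stereo s x)) (proj12 u)
        / h (stereo s (proj12 u))"
proof -
  have nz: "conf_factor x \<noteq> 0" "h (stereo s x) \<noteq> 0" for x
    using conf_factor_pos[of x] H_pos[of x] by simp_all
  show ?thesis
    unfolding pullback_stereo[OF s] chart_laplacian_isothermal[OF conf_factor_pos]
    by (subst scalar_curvature_isothermal_warped[OF pullback_warped_prod[OF s] nz
          conf_factor_differentiable H_diff(1) pd_conf_factor_differentiable H_diff(2)])
      (simp add: conf_factor_curvature)
qed

lemma chart_laplacian_stereo_sum:
  assumes s: "s\<^sup>2 = 1" and S: "finite S" and F: "\<And>k. k \<in> S \<Longrightarrow> smooth_on UNIV (F k)"
  shows "chart_laplacian (pullback_metric g_S2 (stereo s)) (\<lambda>x. \<Sum>k\<in>S. c k * F k x) x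
    = (\<Sum>k\<in>S. c k * chart_laplacian (pullback_metric g_S2 (stereo s)) (F k) x)"
  unfolding pullback_stereo[OF s] chart_laplacian_isothermal[OF conf_factor_pos]
  by (simp add: pd_sum_scaled S F smooth_on_UNIV_D distrib_left
      flip: sum.distrib sum_divide_distrib)

lemma prod_chart_stereo:
  "prod_chart (UNIV, stereo s) ({x. l < x$1 \<and> x$1 < r}, \<lambda>x. cis (x$1))
    = ({u. l < u$3 \<and> u$3 < r}, \<lambda>u. (stereo s (proj12 u), cis (u$3)))"
  by (simp add: prod_chart_def proj12_def)

text \<open>Both circle charts are restrictions of the same map \<open>cis\<close>, so the four
  product charts involve only one formula for each sign.\<close>

lemma S2xS1_atlas_eq:
  "S2xS1_atlas =
    [({u. 0 < u$3 \<and> u$3 < 2 * pi}, \<lambda>u. (stereo 1 (proj12 u), cis (u$3))),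
     ({u. - pi < u$3 \<and> u$3 < pi}, \<lambda>u. (stereo 1 (proj12 u), cis (u$3))),
     ({u. 0 < u$3 \<and> u$3 < 2 * pi}, \<lambda>u. (stereo (-1) (proj12 u), cis (u$3))),
     ({u. - pi < u$3 \<and> u$3 < pi}, \<lambda>u. (stereo (-1) (proj12 u), cis (u$3)))]"
  by (simp add: S2xS1_atlas_def S2_atlas_def S1_atlas_def stereo_N_eq stereo_S_eq prod_chart_stereo)

lemma stereo_in_S2: "s\<^sup>2 = 1 \<Longrightarrow> stereo s u \<in> S2"
  using S2_atlas_covers unfolding S2_atlas_def stereo_N_eq stereo_S_eq
  by (fastforce simp: power2_eq_1_iff)

section \<open>Volume\<close>

lemma prod_UNIV_3: "(\<Prod>i\<in>(UNIV::3 set). f i) = f 1 * f 2 * f 3"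
  unfolding UNIV_3 by (simp add: mult.assoc)

lemma prod_Basis_vec: "(\<Prod>b\<in>(Basis::(real^'n) set). f b) = (\<Prod>i\<in>UNIV. f (axis i 1))"
proof -
  have B: "(Basis::(real^'n) set) = range (\<lambda>i. axis i 1)"
    by (auto simp: Basis_vec_def)
  have "inj (\<lambda>i::'n. axis i (1::real))"
    by (auto simp: inj_def axis_eq_axis)
  then show ?thesis
    unfolding B by (subst prod.reindex) (simp_all add: o_def)
qed

lemma vector3_glue:
  "(\<lambda>(x::real^2, y). vector [x$1, x$2, y] :: real^3)
    = (\<lambda>z. fst z $ 1 *\<^sub>R axis 1 1 + fst z $ 2 *\<^sub>R axis 2 1 + snd z *\<^sub>R axis 3 1)"
  by (auto simp: fun_eq_iff vec_eq_iff forall_3 axis_def)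

lemma measurable_vector3_glue [measurable]:
  "(\<lambda>(x::real^2, y). vector [x$1, x$2, y] :: real^3) \<in> borel_measurable borel"
  unfolding vector3_glue by (intro borel_measurable_continuous_onI continuous_intros)

text \<open>Lebesgue measure is determined by its values on boxes, and the preimage of a box under
  the gluing map is a product of boxes. This gives access to Fubini in the product chart.\<close>

lemma lborel_vec3_eq_distr:
  "(lborel :: (real^3) measure) =
    distr (lborel :: ((real^2) \<times> real) measure) borel (\<lambda>(x, y). vector [x$1, x$2, y] :: real^3)"
    (is "_ = distr _ _ ?T")
proof (rule lborel_eqI)
  fix l u :: "real^3"
  assume lu: "\<And>b. b \<in> Basis \<Longrightarrow> l \<bullet> b \<le> u \<bullet> b"
  have le: "l $ i \<le> u $ i" for i
    using lu[of "axis i 1"] by (simp add: inner_axis)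
  have "?T -` box l u = box (proj12 l) (proj12 u) \<times> box (l$3) (u$3)"
    by (auto simp: mem_box_cart forall_2 forall_3 proj12_def)
  then have "emeasure (distr lborel borel ?T) (box l u)
      = emeasure (lborel :: ((real^2) \<times> real) measure) (box (proj12 l) (proj12 u) \<times> box (l$3) (u$3))"
    using measurable_vector3_glue by (simp add: emeasure_distr)
  also have "\<dots> = emeasure lborel (box (proj12 l) (proj12 u)) * emeasure lborel (box (l$3) (u$3))"
    unfolding lborel_prod[symmetric] by (rule lborel.emeasure_pair_measure_Times) simp_all
  also have "\<dots> = ennreal (u$1 - l$1) * ennreal (u$2 - l$2) * ennreal (u$3 - l$3)"
  proof -
    have "emeasure lborel (box (proj12 l) (proj12 u)) = (\<Prod>b\<in>Basis. (proj12 u - proj12 l) \<bullet> b)"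
    proof (rule emeasure_lborel_box)
      fix b :: "real^2"
      assume "b \<in> Basis"
      then obtain i where "b = axis i 1"
        by (auto simp: Basis_vec_def)
      then show "proj12 l \<bullet> b \<le> proj12 u \<bullet> b"
        using le exhaust_2[of i] by (auto simp: inner_axis proj12_def)
    qed
    also have "\<dots> = ennreal (u$1 - l$1) * ennreal (u$2 - l$2)"
      using le by (simp add: prod_Basis_vec UNIV_2 proj12_def inner_axis ennreal_mult)
    finally show ?thesis
      using le by simp
  qed
  also have "\<dots> = (\<Prod>b\<in>Basis. (u - l) \<bullet> b)"
    unfolding prod_Basis_vec prod_UNIV_3 using le by (simp add: inner_axis ennreal_mult)
  finally show "emeasure (distr lborel borel ?T) (box l u) = (\<Prod>b\<in>Basis. (u - l) \<bullet> b)" .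
qed simp

lemma measurable_proj12 [measurable]: "proj12 \<in> borel_measurable borel"
proof -
  have eq: "proj12 = (\<lambda>u. u $ 1 *\<^sub>R axis 1 1 + u $ 2 *\<^sub>R axis 2 1)"
    by (auto simp: fun_eq_iff vec_eq_iff forall_2 axis_def proj12_def)
  show ?thesis
    unfolding eq by (intro borel_measurable_continuous_onI continuous_intros)
qed

lemma nn_integral_vec3:
  assumes [measurable]: "F \<in> borel_measurable borel" "S \<in> sets borel"
  shows "(\<integral>\<^sup>+u. F (proj12 u) * indicator S (u$3) \<partial>lborel)
    = (\<integral>\<^sup>+x. F x \<partial>lborel) * emeasure lborel S"
proof -
  let ?T = "\<lambda>(x::real^2, y). vector [x$1, x$2, y] :: real^3"
  have [measurable]: "(\<lambda>u::real^3. u$3) \<in> borel_measurable borel"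
    by (intro borel_measurable_continuous_onI continuous_intros)
  have pT: "proj12 (?T z) = fst z" "?T z $ 3 = snd z" for z
    by (auto simp: proj12_def vec_eq_iff forall_2 split: prod.split)
  have "(\<integral>\<^sup>+u. F (proj12 u) * indicator S (u$3) \<partial>lborel)
      = (\<integral>\<^sup>+z. F (fst z) * indicator S (snd z) \<partial>(lborel \<Otimes>\<^sub>M lborel))"
    unfolding lborel_vec3_eq_distr lborel_prod using measurable_vector3_glue
    by (subst nn_integral_distr) (simp_all add: pT)
  also have "\<dots> = (\<integral>\<^sup>+x. \<integral>\<^sup>+y. F x * indicator S y \<partial>lborel \<partial>lborel)"
    by (subst lborel.nn_integral_fst[symmetric]) simp_all
  also have "\<dots> = (\<integral>\<^sup>+x. F x \<partial>lborel) * emeasure lborel S"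
    by (simp add: nn_integral_cmult nn_integral_multc)
  finally show ?thesis .
qed

text \<open>No chart precedes the first one, so it is integrated over the whole plane; the
  contribution of the second chart is nonnegative and dropped. This direction transfers the upper
  bound on the sphere integrals to the plane.\<close>

lemma riem_nn_integral_S2_ge:
  "(\<integral>\<^sup>+x. F (stereo 1 x) * ennreal (conf_factor x) \<partial>lborel) \<le> riem_nn_integral S2_atlas g_S2 F"
proof -
  have "sqrt (det (pullback_metric g_S2 (stereo 1) x)) = conf_factor x" for x
    using conf_factor_pos[of x] by (simp add: pullback_stereo det_diag_metric)
  then show ?thesis
    unfolding riem_nn_integral_def S2_atlas_def stereo_N_eq
    by (simp add: lessThan_Suc numeral_2_eq_2)
qed

section \<open>Overlaps of the charts, and the volume in a single chart\<close>

lemma AE_lborel_component_nonzero: "AE u :: real^'n in lborel. u $ i \<noteq> 0"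
proof -
  have "AE u in lebesgue. u \<notin> {u :: real^'n. u $ i = 0}"
    using negligible_standard_hyperplane_cart[of i]
    by (intro AE_not_in) (simp add: negligible_iff_null_sets)
  then show ?thesis
    by (simp add: AE_completion_iff)
qed

text \<open>Negative angles are shifted by 2 pi. The angle 0 is the only one of the second circle
  chart that the first chart misses.\<close>

lemma cis_in_slit_circle: "cis x \<in> cis ` {0<..<2 * pi}" if "- pi < x" "x < pi" "x \<noteq> 0"
proof (cases "0 < x")
  case True
  then show ?thesis
    using that by auto
next
  case False
  have "cis (x + 2 * pi) = cis x"
    by (simp add: complex_eq_iff)
  then have "cis x = cis (x + 2 * pi)" ..
  then show ?thesis
    using that False by (intro image_eqI[of _ _ "x + 2 * pi"]) auto
qed

text \<open>The transition between the two stereographic charts is inversion in the unit circle. The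
  excluded origin is sent by \<open>stereo (-1)\<close> to the north pole, which
  \<open>stereo 1\<close> omits.\<close>

lemma stereo_antipodal_chart:
  assumes "x \<noteq> 0"
  shows "stereo (-1) x = stereo 1 ((1 / (x \<bullet> x)) *\<^sub>R x)"
proof -
  define r where "r = x \<bullet> x"
  have r: "0 < r"
    using assms by (simp add: r_def)
  have e: "((1 / r) *\<^sub>R x) \<bullet> ((1 / r) *\<^sub>R x) = 1 / r"
    using r by (simp add: r_def)
  show ?thesis
    using r unfolding stereo_def r_def[symmetric] e by (simp add: vec_eq_iff forall_3 field_simps)
qed

lemma measurable_conf_factor [measurable]: "conf_factor \<in> borel_measurable borel"
  by (intro borel_measurable_continuous_onI continuous_at_imp_continuous_on ballI
      differentiable_imp_continuous_within conf_factor_differentiable)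

lemma riem_volume_S2xS1:
  assumes h_pos: "\<And>p. p \<in> S2 \<Longrightarrow> 0 < h p"
    and h_cont: "continuous_on UNIV (\<lambda>x. h (stereo 1 x))"
  shows "riem_volume S2xS1_atlas (warped_metric g_S2 g_S1 h)
    = ennreal (2 * pi) * (\<integral>\<^sup>+x. ennreal (h (stereo 1 x)) * ennreal (conf_factor x) \<partial>lborel)"
proof -
  let ?g = "warped_metric g_S2 g_S1 h"
  define Z where "Z = {u::real^3. 0 < u$3 \<and> u$3 < 2 * pi}"
  define P where "P = {u::real^3. - pi < u$3 \<and> u$3 < pi}"
  define \<phi> where "\<phi> s = (\<lambda>u. (stereo s (proj12 u), cis (u$3)))" for s
  define w where "w s u = ennreal (sqrt (det (pullback_metric ?g (\<phi> s) u)))" for s u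
  have atlas: "S2xS1_atlas = [(Z, \<phi> 1), (P, \<phi> 1), (Z, \<phi> (-1)), (P, \<phi> (-1))]"
    by (simp add: S2xS1_atlas_eq Z_def P_def \<phi>_def)
  have fibre: "\<phi> s u \<in> \<phi> s ` Z" if "u \<in> P" "u$3 \<noteq> 0" for s u
  proof -
    have "cis (u$3) \<in> cis ` {0<..<2 * pi}"
      using that by (intro cis_in_slit_circle) (auto simp: P_def)
    then obtain y where y: "0 < y" "y < 2 * pi" "cis (u$3) = cis y"
      by auto
    have "\<phi> s u = \<phi> s (vector [u$1, u$2, y])"
      by (simp add: \<phi>_def proj12_def y)
    moreover have "vector [u$1, u$2, y] \<in> Z"
      using y by (simp add: Z_def)
    ultimately show ?thesis
      by blast
  qed
  \<comment> \<open>The condition that the first coordinate is nonzero forces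
    \<open>proj12 u\<close> to be nonzero. It discards a whole hyperplane instead of a line, which
    is still a null set.\<close>
  have base: "\<phi> (-1) u \<in> \<phi> 1 ` Z" if "u \<in> Z" "u$1 \<noteq> 0" for u
  proof -
    let ?x = "proj12 u"
    let ?y = "(1 / (?x \<bullet> ?x)) *\<^sub>R ?x"
    have "?x \<noteq> 0"
      using that by (simp add: proj12_def vec_eq_iff forall_2)
    then have "\<phi> (-1) u = (stereo 1 ?y, cis (u$3))"
      by (simp add: \<phi>_def stereo_antipodal_chart)
    also have "\<dots> = \<phi> 1 (vector [?y$1, ?y$2, u$3])"
    proof -
      have "proj12 (vector [?y$1, ?y$2, u$3]) = ?y"
        by (simp add: proj12_def vec_eq_iff forall_2)
      then show ?thesis
        unfolding \<phi>_def by (simp only: vector_3)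
    qed
    finally have "\<phi> (-1) u = \<phi> 1 (vector [?y$1, ?y$2, u$3])" .
    moreover have "vector [?y$1, ?y$2, u$3] \<in> Z"
      using that by (simp add: Z_def)
    ultimately show ?thesis
      by blast
  qed
  \<comment> \<open>The integrand vanishes almost everywhere, so the leftover domains of the later
    charts need only be enclosed in a hyperplane, not determined.\<close>
  have null: "(\<integral>\<^sup>+u\<in>A. 1 * w s u \<partial>lborel) = 0" if "A \<subseteq> {u. u$i = 0}" for A s i
  proof -
    have "AE u in lborel. 1 * w s u * indicator A u = 0"
      using AE_lborel_component_nonzero[of i] by eventually_elim (use that in \<open>auto simp: indicator_def\<close>)
    then have "(\<integral>\<^sup>+u\<in>A. 1 * w s u \<partial>lborel) = (\<integral>\<^sup>+u. 0 \<partial>(lborel :: (real^3) measure))"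
      by (rule nn_integral_cong_AE)
    then show ?thesis
      by simp
  qed
  \<comment> \<open>The domains over which the second, third and fourth charts are integrated, once
    the points covered earlier are removed.\<close>
  define N1 where "N1 = {u\<in>P. \<phi> 1 u \<notin> \<phi> 1 ` Z}"
  define N2 where "N2 = {u\<in>Z. \<phi> (-1) u \<notin> \<phi> 1 ` P \<and> \<phi> (-1) u \<notin> \<phi> 1 ` Z}"
  define N3 where "N3 = {u\<in>P. \<phi> (-1) u \<notin> \<phi> (-1) ` Z \<and> \<phi> (-1) u \<notin> \<phi> 1 ` P \<and> \<phi> (-1) u \<notin> \<phi> 1 ` Z}"
  have "riem_volume S2xS1_atlas ?g = (\<integral>\<^sup>+u\<in>Z. 1 * w 1 u \<partial>lborel) + (\<integral>\<^sup>+u\<in>N1. 1 * w 1 u \<partial>lborel)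
      + (\<integral>\<^sup>+u\<in>N2. 1 * w (-1) u \<partial>lborel) + (\<integral>\<^sup>+u\<in>N3. 1 * w (-1) u \<partial>lborel)"
    unfolding riem_volume_def riem_nn_integral_def atlas w_def N1_def N2_def N3_def
    by (simp add: numeral_eq_Suc All_less_Suc lessThan_Suc add.commute add.left_commute conj_ac)
  moreover have "(\<integral>\<^sup>+u\<in>N1. 1 * w 1 u \<partial>lborel) = 0"
    by (rule null[of _ 3]) (use fibre in \<open>auto simp: N1_def\<close>)
  moreover have "(\<integral>\<^sup>+u\<in>N2. 1 * w (-1) u \<partial>lborel) = 0"
    by (rule null[of _ 1]) (use base in \<open>auto simp: N2_def\<close>)
  moreover have "(\<integral>\<^sup>+u\<in>N3. 1 * w (-1) u \<partial>lborel) = 0"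
    by (rule null[of _ 3]) (use fibre in \<open>auto simp: N3_def\<close>)
  ultimately have "riem_volume S2xS1_atlas ?g = (\<integral>\<^sup>+u\<in>Z. 1 * w 1 u \<partial>lborel)"
    by simp
  also have "\<dots> = (\<integral>\<^sup>+u. ennreal (h (stereo 1 (proj12 u))) * ennreal (conf_factor (proj12 u))
      * indicator {0<..<2 * pi} (u$3) \<partial>lborel)"
  proof (rule nn_integral_cong)
    fix u :: "real^3"
    have "0 < h (stereo 1 (proj12 u))"
      using h_pos[OF stereo_in_S2] by simp
    moreover have "det (pullback_metric ?g (\<phi> 1) u) = (h (stereo 1 (proj12 u)) * conf_factor (proj12 u))\<^sup>2"
      by (simp add: \<phi>_def pullback_warped_prod det_diag_metric prod_UNIV_3 power2_eq_square)
    ultimately have "w 1 u = ennreal (h (stereo 1 (proj12 u))) * ennreal (conf_factor (proj12 u))"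
      using conf_factor_pos[of "proj12 u"] by (simp add: w_def ennreal_mult)
    then show "1 * w 1 u * indicator Z u = ennreal (h (stereo 1 (proj12 u)))
        * ennreal (conf_factor (proj12 u)) * indicator {0<..<2 * pi} (u$3)"
      by (simp add: Z_def indicator_def)
  qed
  also have "\<dots> = (\<integral>\<^sup>+x. ennreal (h (stereo 1 x)) * ennreal (conf_factor x) \<partial>lborel)
      * emeasure lborel {0<..<2 * pi}"
  proof (rule nn_integral_vec3)
    show "(\<lambda>x. ennreal (h (stereo 1 x)) * ennreal (conf_factor x)) \<in> borel_measurable borel"
      using borel_measurable_continuous_onI[OF h_cont] by measurable
  qed simp
  finally show ?thesis
    by (simp add: mult.commute)
qed

text \<open>On the unit square |x|^2 is at most 2, so \<open>conf_factor\<close> is at least 4 /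
  3^2, and the square has measure 1. The bound serves both the lower volume estimate and the search
  for a point where \<open>h j\<close> is small.\<close>

lemma conf_integral_lower_bound:
  assumes "\<And>x. c \<le> F x" "0 \<le> c"
  shows "ennreal (4 / 9 * c) \<le> (\<integral>\<^sup>+x. ennreal (F x) * ennreal (conf_factor x) \<partial>lborel)"
proof -
  let ?Q = "cbox 0 1 :: (real^2) set"
  have "emeasure lborel ?Q = (\<Prod>b\<in>Basis. (1 - 0 :: real^2) \<bullet> b)"
    by (rule emeasure_lborel_cbox) (auto simp: Basis_vec_def inner_axis)
  then have Q: "emeasure lborel ?Q = 1"
    by (simp add: prod_Basis_vec inner_axis)
  have "ennreal (4 / 9 * c) = (\<integral>\<^sup>+x. ennreal (4 / 9 * c) * indicator ?Q x \<partial>lborel)"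
    by (subst nn_integral_cmult_indicator) (simp_all add: Q)
  also have "\<dots> \<le> (\<integral>\<^sup>+x. ennreal (F x) * ennreal (conf_factor x) \<partial>lborel)"
  proof (rule nn_integral_mono)
    fix x :: "real^2"
    have "ennreal (4 / 9 * c) \<le> ennreal (F x) * ennreal (conf_factor x)" if "x \<in> ?Q"
    proof -
      have "0 \<le> x$i \<and> x$i \<le> 1" for i
        using that by (auto simp: mem_box_cart)
      then have "(x$i)\<^sup>2 \<le> 1" for i
        by (simp add: power_le_one)
      from this[of 1] this[of 2] have "x \<bullet> x \<le> 2"
        by (simp add: inner_real2)
      then have "(1 + x \<bullet> x)\<^sup>2 \<le> 3\<^sup>2"
        by (intro power_mono) auto
      then have "4 / 9 \<le> conf_factor x"
        unfolding conf_factor_def using one_plus_inner_pos[of x] by (intro divide_left_mono) auto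
      then have "c * (4 / 9) \<le> F x * conf_factor x"
        using assms by (intro mult_mono) (auto intro: order_trans)
      then show ?thesis
        using assms(1)[of x] assms(2) conf_factor_pos[of x]
        by (simp add: mult.commute ennreal_leI flip: ennreal_mult)
    qed
    then show "ennreal (4 / 9 * c) * indicator ?Q x \<le> ennreal (F x) * ennreal (conf_factor x)"
      by (simp add: indicator_def)
  qed
  finally show ?thesis .
qed

section \<open>Diameter\<close>

text \<open>Speed is bounded instead of length: on the unit interval a speed bound is a length
  bound, and it behaves simply under reparametrization. The finite set \<open>S\<close> absorbs the
  break points of piecewise paths.\<close>

definition speed_path ::
  "'a::euclidean_space set \<Rightarrow> 'a metric_tensor \<Rightarrow> real \<Rightarrow> 'a \<Rightarrow> 'a \<Rightarrow> (real \<Rightarrow> 'a) \<Rightarrow> bool" where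
  "speed_path M g B x y c \<longleftrightarrow> valid_path c \<and> path_image c \<subseteq> M \<and> pathstart c = x \<and> pathfinish c = y \<and>
    (\<exists>S. finite S \<and> (\<forall>t\<in>{0..1} - S.
       sqrt (g (c t) (vector_derivative c (at t)) (vector_derivative c (at t))) \<le> B))"

lemma riem_dist_le_speed:
  assumes "speed_path M g B x y c"
  shows "riem_dist M g x y \<le> ennreal B"
proof -
  obtain S where S: "finite S" and B: "\<And>t. t \<in> {0..1} - S \<Longrightarrow>
      sqrt (g (c t) (vector_derivative c (at t)) (vector_derivative c (at t))) \<le> B"
    using assms by (auto simp: speed_path_def)
  have "AE t in lborel. t \<notin> S"
    using finite_imp_null_set_lborel[OF S] by (rule AE_not_in)
  then have "curve_length g c \<le> (\<integral>\<^sup>+t. ennreal B * indicator {0..1::real} t \<partial>lborel)"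
    unfolding curve_length_def
    by (intro nn_integral_mono_AE, eventually_elim) (use B in \<open>auto simp: indicator_def intro!: ennreal_leI\<close>)
  also have "\<dots> = ennreal B"
    by (subst nn_integral_cmult_indicator) simp_all
  finally have "curve_length g c \<le> ennreal B" .
  moreover have "riem_dist M g x y \<le> curve_length g c"
    unfolding riem_dist_def using assms by (intro Inf_lower) (auto simp: speed_path_def)
  ultimately show ?thesis
    by (rule order_trans[rotated])
qed

text \<open>Each half of \<open>c +++ d\<close> is traversed at double speed, and \<open>hom\<close>
  turns the rescaling of the tangent vector into a factor 2 of the speed.\<close>

lemma speed_path_join:
  assumes c: "speed_path M g B x y c" and d: "speed_path M g B y z d"
    and hom: "\<And>p v a. g p (a *\<^sub>R v) (a *\<^sub>R v) = a\<^sup>2 * g p v v"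
  shows "speed_path M g (2 * B) x z (c +++ d)"
proof -
  obtain S1 where S1: "finite S1" and c_le: "\<And>t. t \<in> {0..1} - S1 \<Longrightarrow>
      sqrt (g (c t) (vector_derivative c (at t)) (vector_derivative c (at t))) \<le> B"
    using c by (auto simp: speed_path_def)
  obtain S2 where S2: "finite S2" and d_le: "\<And>t. t \<in> {0..1} - S2 \<Longrightarrow>
      sqrt (g (d t) (vector_derivative d (at t)) (vector_derivative d (at t))) \<le> B"
    using d by (auto simp: speed_path_def)
  have vc: "valid_path c" and vd: "valid_path d" and ends: "pathfinish c = pathstart d"
    using c d by (auto simp: speed_path_def)
  obtain T1 where T1: "finite T1" "\<And>t. t \<in> {0..1} - T1 \<Longrightarrow> c differentiable (at t)"
    using vc unfolding valid_path_def piecewise_C1_differentiable_on_def C1_differentiable_on_eq by blast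
  obtain T2 where T2: "finite T2" "\<And>t. t \<in> {0..1} - T2 \<Longrightarrow> d differentiable (at t)"
    using vd unfolding valid_path_def piecewise_C1_differentiable_on_def C1_differentiable_on_eq by blast
  \<comment> \<open>The exceptional parameters of both paths, including those where they are not
    differentiable, pulled back to the joined path, together with the endpoints and the junction
    1/2, where the one-sided derivatives may differ.\<close>
  define S where "S = {0, 1/2, 1} \<union> (\<lambda>t. t / 2) ` (S1 \<union> T1) \<union> (\<lambda>t. (t + 1) / 2) ` (S2 \<union> T2)"
  have sqrt_hom: "sqrt (g p (2 *\<^sub>R v) (2 *\<^sub>R v)) = 2 * sqrt (g p v v)" for p v
    by (simp add: hom real_sqrt_mult)
  have "sqrt (g ((c +++ d) t) (vector_derivative (c +++ d) (at t)) (vector_derivative (c +++ d) (at t)))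
      \<le> 2 * B" if t: "t \<in> {0..1} - S" for t
  proof (cases "t < 1 / 2")
    case True
    have *: "2 * t \<in> {0..1} - S1" "2 * t \<notin> T1"
    proof -
      have "2 * t \<notin> S1 \<union> T1"
      proof
        assume "2 * t \<in> S1 \<union> T1"
        then have "t \<in> (\<lambda>t. t / 2) ` (S1 \<union> T1)"
          by (intro image_eqI[of _ _ "2 * t"]) auto
        then show False
          using t by (simp add: S_def)
      qed
      then show "2 * t \<in> {0..1} - S1" "2 * t \<notin> T1"
        using t True by auto
    qed
    then have "c differentiable (at (2 * t))"
      using T1 by auto
    then have "(c has_vector_derivative vector_derivative c (at (2 * t))) (at (2 * t))"
      by (simp add: vector_derivative_works)
    then have "((c \<circ> (\<lambda>t. 2 * t)) has_vector_derivative 2 *\<^sub>R vector_derivative c (at (2 * t))) (at t)"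
      by (intro vector_diff_chain_at) (auto intro!: derivative_eq_intros)
    then have "((c +++ d) has_vector_derivative 2 *\<^sub>R vector_derivative c (at (2 * t))) (at t)"
      by (rule has_vector_derivative_transform_within_open[where S = "{..<1/2}"])
        (use True in \<open>auto simp: joinpaths_def\<close>)
    then have "vector_derivative (c +++ d) (at t) = 2 *\<^sub>R vector_derivative c (at (2 * t))"
      by (rule vector_derivative_at)
    moreover have "(c +++ d) t = c (2 * t)"
      using True by (simp add: joinpaths_def)
    ultimately show ?thesis
      using c_le[OF *(1)] by (simp add: sqrt_hom)
  next
    case False
    then have t2: "1 / 2 < t"
      using t by (auto simp: S_def)
    have *: "2 * t - 1 \<in> {0..1} - S2" "2 * t - 1 \<notin> T2"
    proof -
      have "2 * t - 1 \<notin> S2 \<union> T2"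
      proof
        assume "2 * t - 1 \<in> S2 \<union> T2"
        then have "t \<in> (\<lambda>t. (t + 1) / 2) ` (S2 \<union> T2)"
          by (intro image_eqI[of _ _ "2 * t - 1"]) auto
        then show False
          using t by (simp add: S_def)
      qed
      then show "2 * t - 1 \<in> {0..1} - S2" "2 * t - 1 \<notin> T2"
        using t t2 by auto
    qed
    then have "d differentiable (at (2 * t - 1))"
      using T2 by auto
    then have "(d has_vector_derivative vector_derivative d (at (2 * t - 1))) (at (2 * t - 1))"
      by (simp add: vector_derivative_works)
    then have "((d \<circ> (\<lambda>t. 2 * t - 1)) has_vector_derivative 2 *\<^sub>R vector_derivative d (at (2 * t - 1))) (at t)"
      by (intro vector_diff_chain_at) (auto intro!: derivative_eq_intros)
    then have "((c +++ d) has_vector_derivative 2 *\<^sub>R vector_derivative d (at (2 * t - 1))) (at t)"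
      by (rule has_vector_derivative_transform_within_open[where S = "{1/2<..}"])
        (use t2 in \<open>auto simp: joinpaths_def\<close>)
    then have "vector_derivative (c +++ d) (at t) = 2 *\<^sub>R vector_derivative d (at (2 * t - 1))"
      by (rule vector_derivative_at)
    moreover have "(c +++ d) t = d (2 * t - 1)"
      using t2 by (simp add: joinpaths_def)
    ultimately show ?thesis
      using d_le[OF *(1)] by (simp add: sqrt_hom)
  qed
  moreover have "finite S"
    using S1 S2 T1 T2 by (simp add: S_def)
  moreover have "valid_path (c +++ d)" "path_image (c +++ d) \<subseteq> M" "pathstart (c +++ d) = x"
      "pathfinish (c +++ d) = z"
    using c d ends by (auto simp: speed_path_def intro!: valid_path_join dest: subsetD[OF path_image_join_subset])
  ultimately show ?thesis
    unfolding speed_path_def by blast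
qed

lemma speed_path_mono: "speed_path M g B x y c \<Longrightarrow> B \<le> B' \<Longrightarrow> speed_path M g B' x y c"
  unfolding speed_path_def by (meson order_trans)

lemma speed_pathI:
  assumes "\<And>t. (c has_vector_derivative c' t) (at t)" "continuous_on UNIV c'"
    and "\<And>t. c t \<in> M" "c 0 = x" "c 1 = y"
    and "\<And>t. sqrt (g (c t) (c' t) (c' t)) \<le> B"
  shows "speed_path M g B x y c"
proof -
  have "vector_derivative c (at t) = c' t" for t
    using assms(1) by (rule vector_derivative_at)
  moreover have "valid_path c"
    unfolding valid_path_def using assms(1) continuous_on_subset[OF assms(2)]
    by (intro C1_differentiable_imp_piecewise) (auto simp: C1_differentiable_on_def)
  ultimately show ?thesis
    using assms(3-6) unfolding speed_path_def path_image_def pathstart_def pathfinish_def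
    by (intro conjI exI[of _ "{}"]) auto
qed

text \<open>Gram-Schmidt: \<open>e\<close> is the normalized component of \<open>q\<close>
  orthogonal to \<open>p\<close>, and \<theta> is the angle arccos (p \<bullet> q).\<close>

lemma great_circle_frame:
  fixes p q :: "real^3"
  assumes "norm p = 1" "norm q = 1"
  obtains e \<theta> where "norm e = 1" "p \<bullet> e = 0" "0 \<le> \<theta>" "\<theta> \<le> pi" "q = cos \<theta> *\<^sub>R p + sin \<theta> *\<^sub>R e"
proof -
  define c where "c = p \<bullet> q"
  have pp: "p \<bullet> p = 1" and qq: "q \<bullet> q = 1"
    using assms by (simp_all add: norm_eq_1)
  have c1: "-1 \<le> c" "c \<le> 1"
    using Cauchy_Schwarz_ineq2[of p q] assms by (auto simp: c_def)
  define r where "r = q - c *\<^sub>R p"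
  have pr: "p \<bullet> r = 0"
    by (simp add: r_def inner_diff_right pp c_def)
  have "r \<bullet> r = 1 - c\<^sup>2"
    by (simp add: r_def inner_diff_left inner_diff_right pp qq c_def inner_commute power2_eq_square)
  then have norm_r: "norm r = sqrt (1 - c\<^sup>2)"
    by (simp add: norm_eq_sqrt_inner)
  have sin: "sin (arccos c) = norm r" and cos: "cos (arccos c) = c"
    using c1 by (simp_all add: sin_arccos norm_r)
  obtain e where e: "norm e = 1" "p \<bullet> e = 0" "r = norm r *\<^sub>R e"
  proof (cases "r = 0")
    \<comment> \<open>Here \<open>q\<close> is p or -p. The coefficient of \<open>e\<close> is
      \<open>norm r\<close> = 0, so any unit vector orthogonal to \<open>p\<close> will do.\<close>
    case True
    obtain y :: "real^3" where "y \<noteq> 0" "orthogonal p y"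
      using orthogonal_to_vector_exists[of p] by auto
    then show ?thesis
      using True by (intro that[of "sgn y"]) (auto simp: norm_sgn sgn_div_norm orthogonal_def)
  next
    case False
    then show ?thesis
      using pr by (intro that[of "sgn r"]) (auto simp: norm_sgn sgn_div_norm)
  qed
  show ?thesis
  proof (rule that[of e "arccos c"])
    have "q = c *\<^sub>R p + r"
      by (simp add: r_def)
    then show "q = cos (arccos c) *\<^sub>R p + sin (arccos c) *\<^sub>R e"
      unfolding sin cos using e by simp
  qed (use e c1 arccos_bounded in auto)
qed

text \<open>The velocity has no circle component, so its length is the spherical one, constantly
  \<theta> and at most pi, uniformly in \<open>h\<close>.\<close>

lemma speed_path_great_circle:
  assumes p: "p \<in> S2" and q: "q \<in> S2" and z: "z \<in> S1"
  obtains c where "speed_path (S2 \<times> S1) (warped_metric g_S2 g_S1 h) pi (p, z) (q, z) c"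
proof -
  have "norm p = 1" "norm q = 1"
    using p q by auto
  then obtain e \<theta> where e: "norm e = 1" "p \<bullet> e = 0" and \<theta>: "0 \<le> \<theta>" "\<theta> \<le> pi"
    and q_eq: "q = cos \<theta> *\<^sub>R p + sin \<theta> *\<^sub>R e"
    by (rule great_circle_frame)
  have in1: "p \<bullet> p = 1" "e \<bullet> e = 1" "e \<bullet> p = 0"
    using \<open>norm p = 1\<close> e by (simp_all add: norm_eq_1 inner_commute)
  have norm2: "(a *\<^sub>R p + b *\<^sub>R e) \<bullet> (a *\<^sub>R p + b *\<^sub>R e) = a\<^sup>2 + b\<^sup>2" for a b
    using in1 e by (simp add: inner_add_left inner_add_right power2_eq_square)
  define \<gamma> where "\<gamma> t = cos (\<theta> * t) *\<^sub>R p + sin (\<theta> * t) *\<^sub>R e" for t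
  define \<gamma>' where "\<gamma>' t = (- \<theta> * sin (\<theta> * t)) *\<^sub>R p + (\<theta> * cos (\<theta> * t)) *\<^sub>R e" for t
  have d: "(\<gamma> has_vector_derivative \<gamma>' t) (at t)" for t
  proof -
    have "((\<lambda>t. cos (\<theta> * t)) has_real_derivative - \<theta> * sin (\<theta> * t)) (at t)"
      "((\<lambda>t. sin (\<theta> * t)) has_real_derivative \<theta> * cos (\<theta> * t)) (at t)"
      by (auto intro!: derivative_eq_intros)
    then show ?thesis
      unfolding \<gamma>_def[abs_def] \<gamma>'_def has_real_derivative_iff_has_vector_derivative
      by (intro has_vector_derivative_add bounded_linear.has_vector_derivative[OF bounded_linear_scaleR_left])
  qed
  have "speed_path (S2 \<times> S1) (warped_metric g_S2 g_S1 h) pi (p, z) (q, z) (\<lambda>t. (\<gamma> t, z))"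
  proof (rule speed_pathI[where c' = "\<lambda>t. (\<gamma>' t, 0)"])
    show "((\<lambda>t. (\<gamma> t, z)) has_vector_derivative (\<gamma>' t, 0)) (at t)" for t
      by (intro has_vector_derivative_Pair d has_vector_derivative_const)
    show "continuous_on UNIV (\<lambda>t. (\<gamma>' t, 0))"
      unfolding \<gamma>'_def by (intro continuous_intros)
    show "(\<gamma> t, z) \<in> S2 \<times> S1" for t
      using z by (simp add: \<gamma>_def norm_eq_1 norm2)
    show "(\<gamma> 0, z) = (p, z)" "(\<gamma> 1, z) = (q, z)"
      by (simp_all add: \<gamma>_def q_eq)
    have "\<gamma>' t \<bullet> \<gamma>' t = \<theta>\<^sup>2" for t
      unfolding \<gamma>'_def norm2 by (simp add: power_mult_distrib flip: distrib_left)
    then show "sqrt (warped_metric g_S2 g_S1 h (\<gamma> t, z) (\<gamma>' t, 0) (\<gamma>' t, 0)) \<le> pi" for t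
      using \<theta> by (simp add: warped_metric_def euclid_metric_def)
  qed
  then show ?thesis
    by (rule that)
qed

text \<open>The fibre over \<open>p\<close> is a circle of radius \<open>h p\<close>. The path
  follows the difference of the two arguments, which is at most 2 pi in absolute value since both
  lie in (-pi, pi]; it may be the longer arc.\<close>

lemma speed_path_fibre:
  assumes p: "p \<in> S2" and z: "z \<in> S1" and w: "w \<in> S1" and h: "0 \<le> h p"
  obtains c where "speed_path (S2 \<times> S1) (warped_metric g_S2 g_S1 h) (2 * pi * h p) (p, z) (p, w) c"
proof -
  have zw: "z = cis (Arg z)" "w = cis (Arg w)"
    using z w rcis_cmod_Arg[of z] rcis_cmod_Arg[of w] by (simp_all add: rcis_def)
  define d where "d = Arg w - Arg z"
  have d: "\<bar>d\<bar> \<le> 2 * pi"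
    using Arg_le_pi[of z] Arg_le_pi[of w] mpi_less_Arg[of z] mpi_less_Arg[of w] by (simp add: d_def)
  have "speed_path (S2 \<times> S1) (warped_metric g_S2 g_S1 h) (2 * pi * h p) (p, z) (p, w)
    (\<lambda>t. (p, cis (Arg z + d * t)))"
  proof (rule speed_pathI[where c' = "\<lambda>t. (0, d *\<^sub>R (\<i> * cis (Arg z + d * t)))"])
    show "((\<lambda>t. (p, cis (Arg z + d * t))) has_vector_derivative
        (0, d *\<^sub>R (\<i> * cis (Arg z + d * t)))) (at t)" for t
      by (intro has_vector_derivative_Pair has_vector_derivative_const has_vector_derivative_cis_affine)
    show "continuous_on UNIV (\<lambda>t. (0, d *\<^sub>R (\<i> * cis (Arg z + d * t))))"
      by (intro continuous_intros)
    show "(p, cis (Arg z + d * t)) \<in> S2 \<times> S1" for t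
      using p by simp
    show "(p, cis (Arg z + d * 0)) = (p, z)" "(p, cis (Arg z + d * 1)) = (p, w)"
      using zw by (simp_all add: d_def)
    have "(\<i> * cis a) \<bullet> (\<i> * cis a) = 1" for a
      by (simp add: dot_square_norm norm_mult)
    then have "sqrt (warped_metric g_S2 g_S1 h (p, cis (Arg z + d * t))
        (0, d *\<^sub>R (\<i> * cis (Arg z + d * t))) (0, d *\<^sub>R (\<i> * cis (Arg z + d * t)))) = h p * \<bar>d\<bar>" for t
      using h by (simp add: warped_metric_def euclid_metric_def real_sqrt_mult)
    moreover have "h p * \<bar>d\<bar> \<le> 2 * pi * h p"
      using mult_left_mono[OF d h] by (simp add: mult.commute)
    ultimately show "sqrt (warped_metric g_S2 g_S1 h (p, cis (Arg z + d * t))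
        (0, d *\<^sub>R (\<i> * cis (Arg z + d * t))) (0, d *\<^sub>R (\<i> * cis (Arg z + d * t)))) \<le> 2 * pi * h p" for t
      by simp
  qed
  then show ?thesis
    by (rule that)
qed

text \<open>Any two points are joined by moving along the base to the fibre over \<open>p0\<close>, then along that
  fibre, then along the base again.\<close>

lemma riem_diam_warped_sphere:
  assumes p0: "p0 \<in> S2" and h: "0 \<le> h p0" "h p0 \<le> C"
  shows "riem_diam (S2 \<times> S1) (warped_metric g_S2 g_S1 h) \<le> ennreal (4 * (pi + 2 * pi * C))"
proof -
  let ?g = "warped_metric g_S2 g_S1 h" and ?B = "pi + 2 * pi * C"
  have hom: "?g p (a *\<^sub>R v) (a *\<^sub>R v) = a\<^sup>2 * ?g p v v" for p v a
    by (simp add: warped_metric_def euclid_metric_def power2_eq_square algebra_simps)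
  have C: "0 \<le> C" "2 * pi * h p0 \<le> ?B"
  proof -
    show "0 \<le> C"
      using h by simp
    have "2 * pi * h p0 \<le> 2 * pi * C"
      using h by (intro mult_left_mono) auto
    then show "2 * pi * h p0 \<le> ?B"
      using pi_ge_zero by linarith
  qed
  have "riem_dist (S2 \<times> S1) ?g x y \<le> ennreal (4 * ?B)" if xy: "x \<in> S2 \<times> S1" "y \<in> S2 \<times> S1" for x y
  proof -
    obtain p z q w where xy_eq: "x = (p, z)" "y = (q, w)" and in_S: "p \<in> S2" "z \<in> S1" "q \<in> S2" "w \<in> S1"
      using xy by blast
    obtain c1 where c1: "speed_path (S2 \<times> S1) ?g pi (p, z) (p0, z) c1"
      using speed_path_great_circle in_S p0 by metis
    obtain c2 where c2: "speed_path (S2 \<times> S1) ?g (2 * pi * h p0) (p0, z) (p0, w) c2"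
      using speed_path_fibre in_S p0 h(1) by metis
    obtain c3 where c3: "speed_path (S2 \<times> S1) ?g pi (p0, w) (q, w) c3"
      using speed_path_great_circle in_S p0 by metis
    \<comment> \<open>\<open>?B\<close> dominates the speeds of the base paths and of the fibre
      path. Joining \<open>c1\<close> and \<open>c2\<close> gives the bound 2 * \<open>?B\<close>,
      so \<open>c3\<close> is relaxed to the same bound before the second join doubles it
      again.\<close>
    have "speed_path (S2 \<times> S1) ?g ?B (p, z) (p0, z) c1" "speed_path (S2 \<times> S1) ?g ?B (p0, z) (p0, w) c2"
      "speed_path (S2 \<times> S1) ?g (2 * ?B) (p0, w) (q, w) c3"
      using c1 c2 c3 C by (auto elim!: speed_path_mono)
    then have "speed_path (S2 \<times> S1) ?g (2 * (2 * ?B)) (p, z) (q, w) ((c1 +++ c2) +++ c3)"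
      by (intro speed_path_join hom)
    then show ?thesis
      unfolding xy_eq using riem_dist_le_speed by fastforce
  qed
  then show ?thesis
    unfolding riem_diam_def by (intro SUP_least)
qed

section \<open>Assembly of the estimates for the sequence \<open>h j\<close>\<close>

theorem theorem2p2:
  fixes f :: "nat \<Rightarrow> nat \<Rightarrow> real^3 \<Rightarrow> real"
    and A :: "nat \<Rightarrow> real"
    and h :: "nat \<Rightarrow> real^3 \<Rightarrow> real"
    and g :: "nat \<Rightarrow> ((real^3) \<times> complex) metric_tensor"
    and T K :: real
  assumes f_pos: "\<And>i j p. 1 \<le> i \<Longrightarrow> 1 \<le> j \<Longrightarrow> p \<in> S2 \<Longrightarrow> 0 < f i j p"
    and f_smooth: "\<And>i j. 1 \<le> i \<Longrightarrow> 1 \<le> j \<Longrightarrow> smooth_on_atlas S2_atlas (f i j)"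
    and T_pos: "0 < T"
    and f_int: "\<And>i j. 1 \<le> i \<Longrightarrow> 1 \<le> j \<Longrightarrow>
                  riem_nn_integral S2_atlas g_S2 (\<lambda>p. ennreal (f i j p)) \<le> ennreal T"
    and f_ge2: "\<And>i j p. 1 \<le> i \<Longrightarrow> 1 \<le> j \<Longrightarrow> p \<in> S2 \<Longrightarrow> 2 \<le> f i j p"
    and f_lap: "\<And>i j. 1 \<le> i \<Longrightarrow> 1 \<le> j \<Longrightarrow>
                  \<forall>(U, \<phi>)\<in>set S2_atlas. \<forall>u\<in>U.
                    chart_laplacian (pullback_metric g_S2 \<phi>) (f i j \<circ> \<phi>) u \<le> f i j (\<phi> u)"
    and A_nonneg: "\<And>i. 1 \<le> i \<Longrightarrow> 0 \<le> A i"
    and A1_pos: "0 < A 1"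
    and A_sums: "(\<lambda>i. A (Suc i)) sums K"
    and h_def: "\<And>j p. h j p = (\<Sum>i=1..j. A i * f i j p)"
    and g_def: "\<And>j. g j = warped_metric g_S2 g_S1 (h j)"
  shows "(\<forall>j\<ge>1. \<forall>(U, \<phi>)\<in>set S2xS1_atlas. \<forall>u\<in>U.
             0 \<le> chart_scalar_curvature (pullback_metric (g j) \<phi>) u)
       \<and> (\<exists>v V D :: real. 0 < v \<and> 0 < V \<and> 0 < D \<and>
            (\<forall>j\<ge>1. ennreal v \<le> riem_volume S2xS1_atlas (g j)
                  \<and> riem_volume S2xS1_atlas (g j) \<le> ennreal V
                  \<and> riem_diam (S2 \<times> S1) (g j) \<le> ennreal D))"
proof -
  have f_smooth': "smooth_on UNIV (\<lambda>x. f i j (stereo s x))"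
    if "1 \<le> i" "1 \<le> j" "s = 1 \<or> s = -1" for i j s
    using f_smooth[OF that(1,2)] that(3)
    by (auto simp: smooth_on_atlas_def S2_atlas_def stereo_N_eq stereo_S_eq o_def)
  have f_lap': "chart_laplacian (pullback_metric g_S2 (stereo s)) (\<lambda>x. f i j (stereo s x)) x
      \<le> f i j (stereo s x)" if "1 \<le> i" "1 \<le> j" "s = 1 \<or> s = -1" for i j s x
    using f_lap[OF that(1,2)] that(3) by (auto simp: S2_atlas_def stereo_N_eq stereo_S_eq o_def)
  have h_ge: "2 * A 1 \<le> h j p" if "1 \<le> j" "p \<in> S2" for j p
  proof -
    have "A 1 * 2 \<le> A 1 * f 1 j p"
      using A1_pos f_ge2[of 1 j p] that by (intro mult_left_mono) auto
    also have "\<dots> \<le> h j p"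
      unfolding h_def
    proof (rule member_le_sum)
      show "0 \<le> A i * f i j p" if "i \<in> {1..j} - {1}" for i
        using that \<open>1 \<le> j\<close> \<open>p \<in> S2\<close> A_nonneg[of i] f_pos[of i j p] by simp
    qed (use that in auto)
    finally show ?thesis
      by (simp add: mult.commute)
  qed
  have h_pos: "0 < h j p" if "1 \<le> j" "p \<in> S2" for j p
    using h_ge[OF that] A1_pos by linarith
  have h_stereo: "(\<lambda>x. h j (stereo s x)) = (\<lambda>x. \<Sum>i\<in>{1..j}. A i * f i j (stereo s x))" for j s
    by (simp add: h_def)
  have h_diff: "(\<lambda>x. h j (stereo s x)) differentiable (at x)"
      "pd k (\<lambda>x. h j (stereo s x)) differentiable (at x)"
    if "1 \<le> j" "s = 1 \<or> s = -1" for j s x k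
  proof -
    note F = smooth_on_UNIV_D[OF f_smooth'[OF _ that]]
    show "(\<lambda>x. h j (stereo s x)) differentiable (at x)"
      unfolding h_stereo using F(1) by (intro differentiable_sum) auto
    have "pd k (\<lambda>x. h j (stereo s x)) = (\<lambda>x. \<Sum>i\<in>{1..j}. A i * pd k (\<lambda>x. f i j (stereo s x)) x)"
      unfolding h_stereo using F(1) by (intro pd_sum_scaled) auto
    then show "pd k (\<lambda>x. h j (stereo s x)) differentiable (at x)"
      using F(2) by simp
  qed
  have curvature: "0 \<le> chart_scalar_curvature
      (pullback_metric (g j) (\<lambda>u. (stereo s (proj12 u), cis (u$3)))) u"
    if j: "1 \<le> j" and s: "s = 1 \<or> s = -1" for j s u
  proof -
    have s2: "s\<^sup>2 = 1"
      using s by auto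
    let ?x = "proj12 u"
    have "chart_laplacian (pullback_metric g_S2 (stereo s)) (\<lambda>x. h j (stereo s x)) ?x \<le> h j (stereo s ?x)"
      unfolding h_stereo
      by (subst chart_laplacian_stereo_sum[OF s2])
        (use j s in \<open>auto simp: h_def intro!: f_smooth' sum_mono mult_left_mono f_lap' A_nonneg\<close>)
    moreover have "0 < h j (stereo s x)" for x
      using h_pos[OF j stereo_in_S2[OF s2]] .
    ultimately show ?thesis
      unfolding g_def
      by (subst scalar_curvature_warped_sphere[OF s2 _ h_diff[OF j s]]) (simp_all add: divide_le_eq)
  qed
  \<comment> \<open>The integral of \<open>h j\<close> over the sphere, written in the chart that
    omits the north pole.\<close>
  define I where "I j = (\<integral>\<^sup>+x. ennreal (h j (stereo 1 x)) * ennreal (conf_factor x) \<partial>lborel)" for j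
  have A_le: "(\<Sum>i\<in>{1..j}. A i) \<le> K" for j
  proof -
    \<comment> \<open>The coefficients are indexed from 1, while \<open>A_sums\<close> sums the
      shifted sequence from 0; nonnegativity bounds its partial sums by the total.\<close>
    have "(\<Sum>i\<in>{1..j}. A i) = (\<Sum>i<j. A (Suc i))"
      by (rule sum.reindex_bij_witness[of _ Suc "\<lambda>i. i - 1"]) auto
    also have "\<dots> \<le> K"
      using sum_le_suminf[OF sums_summable[OF A_sums], of "{..<j}"] sums_unique[OF A_sums] A_nonneg
      by auto
    finally show ?thesis .
  qed
  have K_pos: "0 < K"
    using A_le[of 1] A1_pos by simp
  \<comment> \<open>Every summand is integrated separately and contributes at most A_i * T, so the
    bound on the partial sums of \<open>A\<close> makes the result independent of j.\<close>
  have I_le: "I j \<le> ennreal (K * T)" if j: "1 \<le> j" for j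
  proof -
    have f_meas [measurable]: "(\<lambda>x. f i j (stereo 1 x)) \<in> borel_measurable borel" if "1 \<le> i" for i
      using smooth_on_UNIV_D(1)[OF f_smooth'[OF that j]]
      by (intro borel_measurable_continuous_onI continuous_at_imp_continuous_on ballI
          differentiable_imp_continuous_within) auto
    have f_nonneg: "0 \<le> f i j (stereo 1 x)" if "1 \<le> i" for i x
      using f_pos[OF that j stereo_in_S2] by (simp add: less_imp_le)
    have "I j = (\<integral>\<^sup>+x. (\<Sum>i\<in>{1..j}. ennreal (A i) * (ennreal (f i j (stereo 1 x)) * ennreal (conf_factor x))) \<partial>lborel)"
      unfolding I_def
    proof (rule nn_integral_cong)
      fix x
      have "ennreal (h j (stereo 1 x)) = (\<Sum>i\<in>{1..j}. ennreal (A i * f i j (stereo 1 x)))"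
        unfolding h_def using A_nonneg f_nonneg by (intro sum_ennreal[symmetric]) simp
      also have "\<dots> = (\<Sum>i\<in>{1..j}. ennreal (A i) * ennreal (f i j (stereo 1 x)))"
        using A_nonneg f_nonneg by (intro sum.cong ennreal_mult) auto
      finally show "ennreal (h j (stereo 1 x)) * ennreal (conf_factor x)
          = (\<Sum>i\<in>{1..j}. ennreal (A i) * (ennreal (f i j (stereo 1 x)) * ennreal (conf_factor x)))"
        by (simp add: sum_distrib_right mult.assoc)
    qed
    also have "\<dots> = (\<Sum>i\<in>{1..j}. ennreal (A i)
        * (\<integral>\<^sup>+x. ennreal (f i j (stereo 1 x)) * ennreal (conf_factor x) \<partial>lborel))"
      by (subst nn_integral_sum) (auto intro!: sum.cong nn_integral_cmult)
    also have "\<dots> \<le> (\<Sum>i\<in>{1..j}. ennreal (A i) * ennreal T)"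
      using f_int j by (intro sum_mono mult_left_mono order_trans[OF riem_nn_integral_S2_ge]) auto
    also have "\<dots> = ennreal ((\<Sum>i\<in>{1..j}. A i) * T)"
    proof -
      have "(\<Sum>i\<in>{1..j}. ennreal (A i)) = ennreal (\<Sum>i\<in>{1..j}. A i)"
        using A_nonneg by (intro sum_ennreal) simp
      moreover have "0 \<le> (\<Sum>i\<in>{1..j}. A i)"
        using A_nonneg by (intro sum_nonneg) simp
      ultimately show ?thesis
        using T_pos by (simp add: ennreal_mult flip: sum_distrib_right)
    qed
    also have "\<dots> \<le> ennreal (K * T)"
      using A_le T_pos by (intro ennreal_leI mult_right_mono) auto
    finally show ?thesis .
  qed
  have I_ge: "ennreal (4 / 9 * (2 * A 1)) \<le> I j" if "1 \<le> j" for j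
    unfolding I_def using h_ge[OF that stereo_in_S2] A1_pos by (intro conf_integral_lower_bound) auto
  have volume: "riem_volume S2xS1_atlas (g j) = ennreal (2 * pi) * I j" if "1 \<le> j" for j
    unfolding g_def I_def using h_pos h_diff(1) that
    by (intro riem_volume_S2xS1)
      (auto intro!: continuous_at_imp_continuous_on differentiable_imp_continuous_within)
  \<comment> \<open>The integral bound forces \<open>h j\<close> below \<open>C\<close> somewhere; \<open>4 / 9\<close> bounds below the area of a
    piece of the sphere, see \<open>conf_integral_lower_bound\<close>.\<close>
  define C where "C = 9 / 4 * (K * T) + 1"
  have diam: "riem_diam (S2 \<times> S1) (g j) \<le> ennreal (4 * (pi + 2 * pi * C))" if j: "1 \<le> j" for j
  proof -
    have "\<exists>x. h j (stereo 1 x) < C"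
    proof (rule ccontr)
      assume "\<nexists>x. h j (stereo 1 x) < C"
      then have "ennreal (4 / 9 * C) \<le> I j"
        unfolding I_def using K_pos T_pos
        by (intro conf_integral_lower_bound) (auto simp: C_def not_less)
      then have "ennreal (4 / 9 * C) \<le> ennreal (K * T)"
        using I_le[OF j] by (rule order_trans)
      \<comment> \<open>Here 4/9 * C = K * T + 4/9: the summand 1 in \<open>C\<close> makes the
        contradiction strict.\<close>
      then show False
        using K_pos T_pos by (simp add: C_def ennreal_le_iff)
    qed
    then obtain x where "h j (stereo 1 x) < C" ..
    then show ?thesis
      unfolding g_def using h_pos[OF j stereo_in_S2, of 1 x]
      by (intro riem_diam_warped_sphere[OF stereo_in_S2]) (auto intro: less_imp_le)
  qed
  have vol_le: "riem_volume S2xS1_atlas (g j) \<le> ennreal (2 * pi * (K * T))" if "1 \<le> j" for j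
    unfolding volume[OF that] using I_le[OF that] K_pos T_pos
    by (subst ennreal_mult) (auto intro: mult_left_mono)
  have vol_ge: "ennreal (2 * pi * (4 / 9 * (2 * A 1))) \<le> riem_volume S2xS1_atlas (g j)" if "1 \<le> j" for j
    unfolding volume[OF that] using I_ge[OF that] A1_pos
    by (subst ennreal_mult) (auto intro: mult_left_mono)
  have "0 < 4 * (pi + 2 * pi * C)"
    using K_pos T_pos by (auto simp: C_def intro!: mult_pos_pos add_pos_pos)
  moreover have "0 < 2 * pi * (4 / 9 * (2 * A 1))" "0 < 2 * pi * (K * T)"
    using A1_pos K_pos T_pos by simp_all
  moreover have "\<forall>j\<ge>1. \<forall>(U, \<phi>)\<in>set S2xS1_atlas. \<forall>u\<in>U.
      0 \<le> chart_scalar_curvature (pullback_metric (g j) \<phi>) u"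
    using curvature by (auto simp: S2xS1_atlas_eq)
  ultimately show ?thesis
    using vol_le vol_ge diam
    by (intro conjI exI[of _ "2 * pi * (4 / 9 * (2 * A 1))"] exI[of _ "2 * pi * (K * T)"]
        exI[of _ "4 * (pi + 2 * pi * C)"]) auto
qed

end
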